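(* The system of partial differential equations $$\begin{array}{l} 2EF_u-FE_u-EE_v=0,\\ 2GF_v-FG_v-GG_u=0,\\ GE_u+EG_v-2F(F_u+F_v)+(3F-2G)E_v+(3F-2E)G_u=0\end{array}$$ for three unknown functions $E,F,G$ of two variables $(u,v)$ is diagonalizable and semi-Hamiltonian.
   Context: The system is of hydrodynamic type: with $\mathbf Z=(E,F,G)^T$ it has the form $A(\mathbf Z)\mathbf Z_u+B(\mathbf Z)\mathbf Z_v=0$ with $3\times 3$ matrices $A,B$ depending only on $\mathbf Z$. It is considered (locally) in the domain of $(E,F,G)$-space where $E>0$, $EG-F^2>0$, i.e. where $E\,du^2+2F\,du\,dv+G\,dv^2$ is a Riemannian metric. Such a system is called diagonalizable if one can (locally) choose new dependent variables $R^1,R^2,R^3$ (Riemann invariants, functions of $(E,F,G)$) such that the system takes the form $R^i_u=\lambda^i(R)R^i_v$, $i=1,2,3$ (no summation). The $\lambda^i$ are called characteristic speeds. A diagonal system of this form is called semi-Hamiltonian if its characteristic speeds satisfy $$\partial_k\left(\frac{\partial_j\lambda^i}{\lambda^j-\lambda^i}\right)=\partial_j\left(\frac{\partial_k\lambda^i}{\lambda^k-\lambda^i}\right),\qquad \partial_i=\partial/\partial R^i,$$ for all pairwise distinct $i,j,k$. A diagonalizable system is called semi-Hamiltonian if its diagonal form is. *)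

theory Defs
  imports "HOL-Analysis.Analysis"
begin

definition pd :: "'n::finite \<Rightarrow> (real^'n \<Rightarrow> real) \<Rightarrow> real^'n \<Rightarrow> real" where
  "pd k f x = deriv (\<lambda>t. f (x + t *\<^sub>R axis k 1)) 0"

(* Only meant for open S, where pd k f on S depends only on the values of f on S. *)
primrec Ck_on :: "nat \<Rightarrow> (real^'n::finite \<Rightarrow> real) \<Rightarrow> (real^'n) set \<Rightarrow> bool" where
  "Ck_on 0 f S \<longleftrightarrow> continuous_on S f"
| "Ck_on (Suc m) f S \<longleftrightarrow> f differentiable_on S \<and> (\<forall>k. Ck_on m (pd k f) S)"

definition smooth_on :: "(real^'n::finite \<Rightarrow> real) \<Rightarrow> (real^'n) set \<Rightarrow> bool" where
  "smooth_on f S \<longleftrightarrow> (\<forall>m. Ck_on m f S)"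

definition diffeo_on :: "(real^'n::finite) set \<Rightarrow> (real^'n) set \<Rightarrow> (real^'n \<Rightarrow> real^'n) \<Rightarrow> bool" where
  "diffeo_on U V R \<longleftrightarrow>
     open U \<and> open V \<and> bij_betw R U V \<and>
     (\<forall>i. smooth_on (\<lambda>z. R z $ i) U) \<and>
     (\<forall>i. smooth_on (\<lambda>r. inv_into U R r $ i) V)"

(* A first-order system for n unknown functions of (u,v) is a predicate S: S Z w says that
   the equations hold for Z at the point w = (u,v).  The coordinates u and v are the
   components 1 and 2 of real^2. *)
type_synonym 'n pde_system = "(real^2 \<Rightarrow> real^'n) \<Rightarrow> real^2 \<Rightarrow> bool"

definition diagonal_system :: "('n::finite \<Rightarrow> real^'n \<Rightarrow> real) \<Rightarrow> 'n pde_system" where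
  "diagonal_system lam r w \<longleftrightarrow>
     (\<forall>i. pd 1 (\<lambda>w. r w $ i) w = lam i (r w) * pd 2 (\<lambda>w. r w $ i) w)"

(* In the new dependent variables R, defined on U and taking values in V, the system S
   becomes the diagonal system with characteristic speeds lam.  The two sets of equations
   are required to be equivalent at every single point, so that in particular Z solves S
   on an open set iff R o Z solves the diagonal system there. *)
definition diagonal_form ::
  "'n::finite pde_system \<Rightarrow> (real^'n) set \<Rightarrow> (real^'n) set \<Rightarrow> (real^'n \<Rightarrow> real^'n)
     \<Rightarrow> ('n \<Rightarrow> real^'n \<Rightarrow> real) \<Rightarrow> bool" where
  "diagonal_form S U V R lam \<longleftrightarrow>
     diffeo_on U V R \<and> (\<forall>i. smooth_on (lam i) V) \<and>
     (\<forall>Z w. Z differentiable (at w) \<longrightarrow> Z w \<in> U \<longrightarrow>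
        (S Z w \<longleftrightarrow> diagonal_system lam (\<lambda>w. R (Z w)) w))"

definition diagonalizable_on :: "(real^'n::finite) set \<Rightarrow> 'n pde_system \<Rightarrow> bool" where
  "diagonalizable_on D S \<longleftrightarrow>
     (\<forall>z\<in>D. \<exists>U V R lam. z \<in> U \<and> U \<subseteq> D \<and> diagonal_form S U V R lam)"

(* The speeds are required to be distinct so that all the quotients are genuine. *)
definition semi_hamiltonian_speeds ::
  "(real^'n::finite) set \<Rightarrow> ('n \<Rightarrow> real^'n \<Rightarrow> real) \<Rightarrow> bool" where
  "semi_hamiltonian_speeds V lam \<longleftrightarrow>
     (\<forall>r\<in>V. \<forall>i j. i \<noteq> j \<longrightarrow> lam i r \<noteq> lam j r) \<and>
     (\<forall>r\<in>V. \<forall>i j k. i \<noteq> j \<longrightarrow> i \<noteq> k \<longrightarrow> j \<noteq> k \<longrightarrow>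
        pd k (\<lambda>r. pd j (lam i) r / (lam j r - lam i r)) r =
        pd j (\<lambda>r. pd k (lam i) r / (lam k r - lam i r)) r)"

(* Riemann invariants are not unique; the condition is imposed on every local diagonal form. *)
definition semi_hamiltonian_on :: "(real^'n::finite) set \<Rightarrow> 'n pde_system \<Rightarrow> bool" where
  "semi_hamiltonian_on D S \<longleftrightarrow>
     diagonalizable_on D S \<and>
     (\<forall>U V R lam. U \<subseteq> D \<longrightarrow> diagonal_form S U V R lam \<longrightarrow> semi_hamiltonian_speeds V lam)"

(* A point z = (E,F,G) stands for the quadratic form E du^2 + 2 F du dv + G dv^2. *)
definition metric_domain :: "(real^3) set" where
  "metric_domain = {z. z $ 1 > 0 \<and> z $ 1 * z $ 3 - (z $ 2)\<^sup>2 > 0}"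

definition metric_system :: "3 pde_system" where
  "metric_system Z w \<longleftrightarrow>
     (let E = Z w $ 1; F = Z w $ 2; G = Z w $ 3;
          Eu = pd 1 (\<lambda>w. Z w $ 1) w; Ev = pd 2 (\<lambda>w. Z w $ 1) w;
          Fu = pd 1 (\<lambda>w. Z w $ 2) w; Fv = pd 2 (\<lambda>w. Z w $ 2) w;
          Gu = pd 1 (\<lambda>w. Z w $ 3) w; Gv = pd 2 (\<lambda>w. Z w $ 3) w
      in 2 * E * Fu - F * Eu - E * Ev = 0 \<and>
         2 * G * Fv - F * Gv - G * Gu = 0 \<and>
         G * Eu + E * Gv - 2 * F * (Fu + Fv) + (3 * F - 2 * G) * Ev + (3 * F - 2 * E) * Gu = 0)"

end

theory Submission
  imports Defs
begin

text \<open>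
  Let \<open>D = E G - F\<^sup>2\<close> and \<open>\<psi> = (E, F, G) / D\<^bsup>2/3\<^esup>\<close>, and write \<open>n(x) = (1, - 2 x, x\<^sup>2)\<close>. The
  characteristic speeds are the roots of
  \<open>p(x) = G x\<^sup>2 (x - 2) + F x (x + 1) + E (1 - 2 x)\<close>; since \<open>p(0) = E > 0\<close> and
  \<open>p(1) = - (E - 2 F + G) < 0\<close>, there is one root in each of the intervals \<open>x < 0\<close>, \<open>0 < x < 1\<close>,
  \<open>x > 1\<close>. In terms of \<open>\<psi>\<close> the system says \<open>\<langle>n(x), \<psi>\<^sub>u - x \<psi>\<^sub>v\<rangle> = 0\<close> for every root \<open>x\<close>.

  The roots of \<open>p\<close> are the critical points of \<open>x \<mapsto> \<langle>n(x), \<psi>\<rangle> / (x (1 - x))\<^bsup>2/3\<^esup>\<close>. So its critical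
  values have differentials proportional to \<open>n(x)\<close>, and they (or their cubes, which are rational in
  \<open>x, E, F, G\<close>) are Riemann invariants.

  Conversely, in any diagonal form with speeds \<open>\<lambda>\<^sup>i\<close> the derivatives \<open>\<partial>\<^sub>j \<psi>\<close> are annihilated by
  \<open>n(\<lambda>\<^sup>i)\<close> for \<open>i \<noteq> j\<close>, which expresses them through \<open>c\<^sub>j = \<partial>\<^sub>j c\<close>, where \<open>c\<close> is the last
  component of \<open>\<psi>\<close>. Differentiating \<open>p(\<lambda>\<^sup>i) = 0\<close> gives \<open>\<partial>\<^sub>j \<lambda>\<^sup>i\<close> in terms of \<open>c\<^sub>j\<close>, and
  \<open>\<partial>\<^sub>j \<partial>\<^sub>k \<psi> = \<partial>\<^sub>k \<partial>\<^sub>j \<psi>\<close> gives \<open>\<partial>\<^sub>k c\<^sub>j\<close>. With these, \<open>\<partial>\<^sub>k (\<partial>\<^sub>j \<lambda>\<^sup>i / (\<lambda>\<^sup>j - \<lambda>\<^sup>i))\<close> comes out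
  as an expression that is visibly symmetric in \<open>j\<close> and \<open>k\<close>.
\<close>

section \<open>Calculus of smooth functions\<close>

lemma pd_eqI:
  assumes "(f has_derivative f') (at x)"
  shows "pd k f x = f' (axis k 1)"
proof -
  have "((\<lambda>t::real. f (x + t *\<^sub>R axis k 1)) has_derivative (\<lambda>t. f' (t *\<^sub>R axis k 1))) (at 0)"
    by (rule has_derivative_compose[of "\<lambda>t. x + t *\<^sub>R axis k 1" "\<lambda>t. t *\<^sub>R axis k 1" 0 UNIV f f'])
       (auto intro!: derivative_eq_intros assms)
  moreover have "f' (t *\<^sub>R axis k 1) = f' (axis k 1) * t" for t
    using linear_scale[OF has_derivative_linear[OF assms]] by simp
  ultimately have "((\<lambda>t::real. f (x + t *\<^sub>R axis k 1)) has_field_derivative f' (axis k 1)) (at 0)"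
    by (simp add: has_field_derivative_def)
  then show ?thesis
    unfolding pd_def by (rule DERIV_imp_deriv)
qed

lemma has_derivative_pd:
  fixes f :: "real^'n::finite \<Rightarrow> real"
  assumes "f differentiable (at x)"
  shows "(f has_derivative (\<lambda>h. \<Sum>k\<in>UNIV. h $ k * pd k f x)) (at x)"
proof -
  obtain f' where f': "(f has_derivative f') (at x)"
    using assms by (auto simp: differentiable_def)
  have lin: "linear f'"
    by (rule has_derivative_linear[OF f'])
  have "f' h = (\<Sum>k\<in>UNIV. h $ k * pd k f x)" for h
  proof -
    have "f' h = f' (\<Sum>k\<in>UNIV. h $ k *\<^sub>R axis k 1)"
      using basis_expansion[of h] by (simp add: scalar_mult_eq_scaleR)
    also have "\<dots> = (\<Sum>k\<in>UNIV. h $ k * pd k f x)"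
      by (simp add: linear_sum[OF lin] linear_scale[OF lin] pd_eqI[OF f'])
    finally show ?thesis .
  qed
  then have "f' = (\<lambda>h. \<Sum>k\<in>UNIV. h $ k * pd k f x)"
    by blast
  with f' show ?thesis by simp
qed

lemma has_derivative_vec_lambda:
  fixes f :: "'a::real_normed_vector \<Rightarrow> real^'n::finite"
  assumes "\<And>i. ((\<lambda>x. f x $ i) has_derivative f' i) F"
  shows "(f has_derivative (\<lambda>h. \<chi> i. f' i h)) F"
proof -
  have "((\<lambda>x. \<Sum>i\<in>UNIV. f x $ i *\<^sub>R axis i (1::real)) has_derivative
         (\<lambda>h. \<Sum>i\<in>UNIV. f' i h *\<^sub>R axis i 1)) F"
    by (intro derivative_intros assms)
  moreover have "(\<Sum>i\<in>UNIV. f x $ i *\<^sub>R axis i (1::real)) = f x" for x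
    using basis_expansion[of "f x"] by (simp add: scalar_mult_eq_scaleR)
  moreover have "(\<Sum>i\<in>UNIV. f' i h *\<^sub>R axis i (1::real)) = (\<chi> i. f' i h)" for h
    using basis_expansion[of "\<chi> i. f' i h"] by (simp add: scalar_mult_eq_scaleR)
  ultimately show ?thesis by simp
qed

lemma has_derivative_vec_nth:
  "(f has_derivative f') F \<Longrightarrow> ((\<lambda>x. f x $ i) has_derivative (\<lambda>h. f' h $ i)) F"
  by (rule bounded_linear.has_derivative[OF bounded_linear_vec_nth])

lemma sum_axis_mult: "(\<Sum>k\<in>UNIV. axis i 1 $ k * c k) = (c i :: real)"
  for i :: "'n::finite"
proof -
  have "(\<Sum>k\<in>UNIV. axis i 1 $ k * c k) = (\<Sum>k\<in>UNIV. if k = i then c k else 0)"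
    by (rule sum.cong) (auto simp: axis_def)
  then show ?thesis by simp
qed

lemma pd_cong:
  assumes "open S" "x \<in> S" "\<And>y. y \<in> S \<Longrightarrow> f y = g y"
  shows "pd k f x = pd k g x"
proof -
  have "open ((\<lambda>t. x + t *\<^sub>R axis k 1) -` S :: real set)"
    by (intro open_vimage assms continuous_intros)
  then have "\<forall>\<^sub>F t in nhds 0. t \<in> ((\<lambda>t. x + t *\<^sub>R axis k 1) -` S :: real set)"
    by (rule eventually_nhds_in_open) (simp add: assms(2))
  then show ?thesis
    unfolding pd_def by (intro deriv_cong_ev refl) (auto elim!: eventually_mono simp: assms(3))
qed

lemma Ck_on_cong:
  "open S \<Longrightarrow> (\<And>y. y \<in> S \<Longrightarrow> f y = g y) \<Longrightarrow> Ck_on m f S \<Longrightarrow> Ck_on m g S"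
proof (induction m arbitrary: f g)
  case 0
  then show ?case by (simp cong: continuous_on_cong)
next
  case (Suc m)
  have "Ck_on m (pd k g) S" for k
  proof (rule Suc.IH)
    show "open S" "Ck_on m (pd k f) S" using Suc.prems by auto
    show "pd k f y = pd k g y" if "y \<in> S" for y
      by (rule pd_cong[OF Suc.prems(1) that Suc.prems(2)])
  qed
  moreover have "g differentiable_on S"
    unfolding differentiable_on_def
  proof
    fix x assume "x \<in> S"
    then show "g differentiable (at x within S)"
      using Suc.prems(2,3) differentiable_transform_within[of f x S 1 g]
      by (simp add: differentiable_on_def)
  qed
  ultimately show ?case by simp
qed

text \<open>Lets inductions over \<open>Ck_on\<close> work with a closed formula for the derivative
  in place of \<open>pd\<close>: only the values of \<open>f'\<close> on the axes have to be one
  order less regular.\<close>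

lemma Ck_on_SucI:
  assumes "open S" "\<And>x. x \<in> S \<Longrightarrow> (f has_derivative f' x) (at x)"
    "\<And>k. Ck_on m (\<lambda>x. f' x (axis k 1)) S"
  shows "Ck_on (Suc m) f S"
proof -
  have "Ck_on m (pd k f) S" for k
    by (rule Ck_on_cong[OF assms(1) _ assms(3)[of k]]) (simp add: pd_eqI[OF assms(2)])
  moreover have "f differentiable_on S"
    unfolding differentiable_on_def
    using assms(2) differentiableI differentiable_at_withinI by blast
  ultimately show ?thesis by simp
qed

lemma Ck_on_Suc_has_derivative:
  assumes "open S" "Ck_on (Suc m) f S" "x \<in> S"
  shows "(f has_derivative (\<lambda>h. \<Sum>k\<in>UNIV. h $ k * pd k f x)) (at x)"
  using assms by (intro has_derivative_pd) (simp add: differentiable_on_eq_differentiable_at)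

lemma Ck_on_SucD: "Ck_on (Suc m) f S \<Longrightarrow> Ck_on m f S"
proof (induction m arbitrary: f)
  case (Suc m)
  then show ?case by simp
qed (simp add: differentiable_imp_continuous_on)

lemma Ck_on_pd: "Ck_on (Suc m) f S \<Longrightarrow> Ck_on m (pd k f) S"
  by simp

lemma Ck_on_subset: "Ck_on m f S \<Longrightarrow> T \<subseteq> S \<Longrightarrow> Ck_on m f T"
proof (induction m arbitrary: f)
  case 0
  then show ?case by (simp add: continuous_on_subset[of S])
next
  case (Suc m)
  then show ?case using differentiable_on_subset[of f S T] by simp
qed

lemma Ck_on_const: "open S \<Longrightarrow> Ck_on m (\<lambda>x. c) S"
proof (induction m arbitrary: c)
  case (Suc m)
  show ?case
    by (intro Ck_on_SucI[of _ _ "\<lambda>x h. 0"] Suc has_derivative_const)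
qed simp

lemma Ck_on_nth: "open S \<Longrightarrow> Ck_on m (\<lambda>x. x $ i) S"
proof (cases m)
  case (Suc m')
  assume "open S"
  then show ?thesis
    unfolding Suc
    by (intro Ck_on_SucI[of _ _ "\<lambda>x h. h $ i"] Ck_on_const bounded_linear_imp_has_derivative
          bounded_linear_vec_nth)
qed (simp add: continuous_on_component)

lemma Ck_on_add:
  "open S \<Longrightarrow> Ck_on m f S \<Longrightarrow> Ck_on m g S \<Longrightarrow> Ck_on m (\<lambda>x. f x + g x) S"
proof (induction m arbitrary: f g)
  case (Suc m)
  have "Ck_on m (\<lambda>x. pd k f x + pd k g x) S" for k
    by (intro Suc.IH Suc.prems Ck_on_pd)
  then show ?case
    by (intro Ck_on_SucI[OF Suc.prems(1) has_derivative_add[OF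
          Ck_on_Suc_has_derivative[OF Suc.prems(1,2)] Ck_on_Suc_has_derivative[OF Suc.prems(1,3)]]])
       (simp_all only: sum_axis_mult)
qed (auto intro: continuous_intros)

lemma Ck_on_mult:
  "open S \<Longrightarrow> Ck_on m f S \<Longrightarrow> Ck_on m g S \<Longrightarrow> Ck_on m (\<lambda>x. f x * g x) S"
proof (induction m arbitrary: f g)
  case (Suc m)
  have "Ck_on m (\<lambda>x. f x * pd k g x + pd k f x * g x) S" for k
    by (intro Ck_on_add Suc.IH Suc.prems Ck_on_pd Ck_on_SucD[OF Suc.prems(2)]
          Ck_on_SucD[OF Suc.prems(3)])
  then show ?case
    by (intro Ck_on_SucI[OF Suc.prems(1) has_derivative_mult[OF
          Ck_on_Suc_has_derivative[OF Suc.prems(1,2)] Ck_on_Suc_has_derivative[OF Suc.prems(1,3)]]])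
       (simp_all only: sum_axis_mult)
qed (auto intro: continuous_intros)

lemma Ck_on_sum:
  "open S \<Longrightarrow> (\<And>i. i \<in> I \<Longrightarrow> Ck_on m (f i) S) \<Longrightarrow> Ck_on m (\<lambda>x. \<Sum>i\<in>I. f i x) S"
  by (induction I rule: infinite_finite_induct) (auto intro: Ck_on_add Ck_on_const)

lemma Ck_on_prod:
  "open S \<Longrightarrow> (\<And>i. i \<in> I \<Longrightarrow> Ck_on m (f i) S) \<Longrightarrow> Ck_on m (\<lambda>x. \<Prod>i\<in>I. f i x) S"
  by (induction I rule: infinite_finite_induct) (auto intro: Ck_on_mult Ck_on_const)

lemma Ck_on_inverse:
  "open S \<Longrightarrow> Ck_on m f S \<Longrightarrow> (\<And>x. x \<in> S \<Longrightarrow> f x \<noteq> 0) \<Longrightarrow> Ck_on m (\<lambda>x. inverse (f x)) S"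
proof (induction m)
  case (Suc m)
  have inv: "Ck_on m (\<lambda>x. inverse (f x)) S"
    by (rule Suc.IH[OF Suc.prems(1) Ck_on_SucD[OF Suc.prems(2)] Suc.prems(3)])
  have "Ck_on m (\<lambda>x. - 1 * (inverse (f x) * pd k f x * inverse (f x))) S" for k
    by (intro Ck_on_mult inv Ck_on_pd Ck_on_const Suc.prems)
  then show ?case
    by (intro Ck_on_SucI[OF Suc.prems(1) Deriv.has_derivative_inverse[OF Suc.prems(3)
          Ck_on_Suc_has_derivative[OF Suc.prems(1,2)]]])
       (simp_all only: sum_axis_mult minus_mult_left[symmetric] mult_1_left)
qed (auto intro: continuous_intros)

lemma Ck_on_diff:
  assumes "open S" "Ck_on m f S" "Ck_on m g S"
  shows "Ck_on m (\<lambda>x. f x - g x) S"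
  using Ck_on_add[OF assms(1,2) Ck_on_mult[OF assms(1) Ck_on_const[OF assms(1), of m "- 1"] assms(3)]]
  by simp

lemma Ck_on_power: "open S \<Longrightarrow> Ck_on m f S \<Longrightarrow> Ck_on m (\<lambda>x. f x ^ n) S"
  by (induction n) (simp_all add: Ck_on_mult Ck_on_const)

lemma Ck_on_divide:
  "open S \<Longrightarrow> Ck_on m f S \<Longrightarrow> Ck_on m g S \<Longrightarrow> (\<And>x. x \<in> S \<Longrightarrow> g x \<noteq> 0) \<Longrightarrow>
     Ck_on m (\<lambda>x. f x / g x) S"
  by (simp add: divide_inverse Ck_on_mult Ck_on_inverse)

text \<open>The exponent is kept arbitrary in the induction, because the derivative contains the
  power with exponent \<open>a - 1\<close>.\<close>

lemma Ck_on_powr: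
  "open S \<Longrightarrow> Ck_on m f S \<Longrightarrow> (\<And>x. x \<in> S \<Longrightarrow> f x > 0) \<Longrightarrow> Ck_on m (\<lambda>x. f x powr a) S"
proof (induction m arbitrary: a)
  case 0
  then have "\<forall>x\<in>S. f x \<noteq> 0" by fastforce
  with 0 show ?case by (auto intro!: continuous_on_powr continuous_on_const)
next
  case (Suc m)
  have "Ck_on m (\<lambda>x. f x powr (a - 1)) S"
    by (rule Suc.IH[OF Suc.prems(1) Ck_on_SucD[OF Suc.prems(2)] Suc.prems(3)])
  then have "Ck_on m (\<lambda>x. a * (f x powr (a - 1) * pd k f x)) S" for k
    by (intro Ck_on_mult Ck_on_pd Ck_on_const Suc.prems)
  moreover have "((\<lambda>x. f x powr a) has_derivative
      (\<lambda>h. a * (f x powr (a - 1) * (\<Sum>k\<in>UNIV. h $ k * pd k f x)))) (at x)" if "x \<in> S" for x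
  proof -
    have "((\<lambda>t. t powr a) has_derivative (*) (a * f x powr (a - 1))) (at (f x))"
      using has_real_derivative_powr[OF Suc.prems(3)[OF that], of a]
      by (simp add: has_field_derivative_def)
    from has_derivative_compose[OF Ck_on_Suc_has_derivative[OF Suc.prems(1,2) that] this]
    show ?thesis by (simp add: mult.assoc)
  qed
  ultimately show ?case
    by (rule_tac Ck_on_SucI[OF Suc.prems(1)]) (assumption, simp only: sum_axis_mult)
qed

text \<open>By the chain rule the partial derivatives are sums of products of
  \<open>pd j f (g x)\<close> with derivatives of the components of \<open>g\<close>. The induction
  hypothesis is used for \<open>pd j f\<close> with the same \<open>g\<close>, so only
  \<open>f\<close> is generalized.\<close>

lemma Ck_on_compose:
  fixes g :: "real^'n::finite \<Rightarrow> real^'m::finite"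
  assumes "open S" "open T" "g ` S \<subseteq> T"
  shows "Ck_on m f T \<Longrightarrow> (\<And>i. Ck_on m (\<lambda>x. g x $ i) S) \<Longrightarrow> Ck_on m (\<lambda>x. f (g x)) S"
proof (induction m arbitrary: f)
  case 0
  have "continuous_on S g"
    using continuous_on_vec_lambda[of S "\<lambda>i x. g x $ i"] 0 by simp
  then have "continuous_on S (\<lambda>x. f (g x))"
    by (rule continuous_on_compose2[OF 0(1)[unfolded Ck_on.simps] _ assms(3)])
  then show ?case
    by (simp only: Ck_on.simps)
next
  case (Suc m)
  have "Ck_on m (\<lambda>x. pd j f (g x)) S" for j
    by (rule Suc.IH[OF Ck_on_pd[OF Suc.prems(1)] Ck_on_SucD[OF Suc.prems(2)]])
  then have *: "Ck_on m (\<lambda>x. \<Sum>j\<in>UNIV. pd k (\<lambda>x. g x $ j) x * pd j f (g x)) S" for k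
    by (intro Ck_on_sum Ck_on_mult assms(1) Ck_on_pd[OF Suc.prems(2)])
  show ?case
  proof (rule Ck_on_SucI[OF assms(1)])
    fix x assume x: "x \<in> S"
    have "(g has_derivative (\<lambda>h. \<chi> i. \<Sum>k\<in>UNIV. h $ k * pd k (\<lambda>x. g x $ i) x)) (at x)"
      by (intro has_derivative_vec_lambda Ck_on_Suc_has_derivative[OF assms(1) Suc.prems(2) x])
    from has_derivative_compose[OF this Ck_on_Suc_has_derivative[OF assms(2) Suc.prems(1)]]
    show "((\<lambda>x. f (g x)) has_derivative (\<lambda>h. \<Sum>j\<in>UNIV.
            (\<Sum>k\<in>UNIV. h $ k * pd k (\<lambda>x. g x $ j) x) * pd j f (g x))) (at x)"
      using x assms(3) by auto
  next
    fix k
    show "Ck_on m (\<lambda>x. \<Sum>j\<in>UNIV. (\<Sum>l\<in>UNIV. axis k 1 $ l * pd l (\<lambda>x. g x $ j) x) * pd j f (g x)) S"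
      using * by (simp only: sum_axis_mult)
  qed
qed

lemma smooth_on_const: "open S \<Longrightarrow> smooth_on (\<lambda>x. c) S"
  by (simp add: smooth_on_def Ck_on_const)

lemma smooth_on_nth: "open S \<Longrightarrow> smooth_on (\<lambda>x. x $ i) S"
  by (simp add: smooth_on_def Ck_on_nth)

lemma smooth_on_add:
  "open S \<Longrightarrow> smooth_on f S \<Longrightarrow> smooth_on g S \<Longrightarrow> smooth_on (\<lambda>x. f x + g x) S"
  by (simp add: smooth_on_def Ck_on_add)

lemma smooth_on_mult:
  "open S \<Longrightarrow> smooth_on f S \<Longrightarrow> smooth_on g S \<Longrightarrow> smooth_on (\<lambda>x. f x * g x) S"
  by (simp add: smooth_on_def Ck_on_mult)

lemma smooth_on_diff:
  "open S \<Longrightarrow> smooth_on f S \<Longrightarrow> smooth_on g S \<Longrightarrow> smooth_on (\<lambda>x. f x - g x) S"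
  by (simp add: smooth_on_def Ck_on_diff)

lemma smooth_on_power: "open S \<Longrightarrow> smooth_on f S \<Longrightarrow> smooth_on (\<lambda>x. f x ^ n) S"
  by (simp add: smooth_on_def Ck_on_power)

lemma smooth_on_sum:
  "open S \<Longrightarrow> (\<And>i. i \<in> I \<Longrightarrow> smooth_on (f i) S) \<Longrightarrow> smooth_on (\<lambda>x. \<Sum>i\<in>I. f i x) S"
  by (simp add: smooth_on_def Ck_on_sum)

lemma smooth_on_prod:
  "open S \<Longrightarrow> (\<And>i. i \<in> I \<Longrightarrow> smooth_on (f i) S) \<Longrightarrow> smooth_on (\<lambda>x. \<Prod>i\<in>I. f i x) S"
  by (simp add: smooth_on_def Ck_on_prod)

lemma smooth_on_divide:
  "open S \<Longrightarrow> smooth_on f S \<Longrightarrow> smooth_on g S \<Longrightarrow> (\<And>x. x \<in> S \<Longrightarrow> g x \<noteq> 0) \<Longrightarrow>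
     smooth_on (\<lambda>x. f x / g x) S"
  by (simp add: smooth_on_def Ck_on_divide)

lemma smooth_on_powr:
  "open S \<Longrightarrow> smooth_on f S \<Longrightarrow> (\<And>x. x \<in> S \<Longrightarrow> f x > 0) \<Longrightarrow> smooth_on (\<lambda>x. f x powr a) S"
  by (simp add: smooth_on_def Ck_on_powr)

lemma smooth_on_compose:
  fixes g :: "real^'n::finite \<Rightarrow> real^'m::finite"
  assumes "open S" "open T" "g ` S \<subseteq> T" "smooth_on f T" "\<And>i. smooth_on (\<lambda>x. g x $ i) S"
  shows "smooth_on (\<lambda>x. f (g x)) S"
  using assms by (simp add: smooth_on_def Ck_on_compose)

lemma smooth_on_pd: "smooth_on f S \<Longrightarrow> smooth_on (pd k f) S"
  unfolding smooth_on_def by (blast intro: Ck_on_pd)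

lemma smooth_on_subset: "smooth_on f S \<Longrightarrow> T \<subseteq> S \<Longrightarrow> smooth_on f T"
  unfolding smooth_on_def by (blast intro: Ck_on_subset)

lemma smooth_on_cong:
  "open S \<Longrightarrow> (\<And>y. y \<in> S \<Longrightarrow> f y = g y) \<Longrightarrow> smooth_on f S \<Longrightarrow> smooth_on g S"
  unfolding smooth_on_def using Ck_on_cong by blast

lemma smooth_on_has_derivative:
  "open S \<Longrightarrow> smooth_on f S \<Longrightarrow> x \<in> S \<Longrightarrow>
     (f has_derivative (\<lambda>h. \<Sum>k\<in>UNIV. h $ k * pd k f x)) (at x)"
  unfolding smooth_on_def by (blast intro: Ck_on_Suc_has_derivative)

lemma smooth_on_imp_continuous_on: "smooth_on f S \<Longrightarrow> continuous_on S f"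
  unfolding smooth_on_def by (drule spec[of _ 0]) simp

lemmas smooth_on_intros =
  smooth_on_const smooth_on_nth smooth_on_add smooth_on_mult smooth_on_diff smooth_on_power
  smooth_on_divide smooth_on_sum smooth_on_prod smooth_on_powr

section \<open>Symmetry of second derivatives and local diffeomorphisms\<close>

lemma has_real_derivative_along_axis:
  assumes "f differentiable (at (y + t *\<^sub>R axis k 1))"
  shows "((\<lambda>t. f (y + t *\<^sub>R axis k 1)) has_real_derivative pd k f (y + t *\<^sub>R axis k 1)) (at t)"
proof -
  have d: "((\<lambda>t. y + t *\<^sub>R axis k 1) has_derivative (\<lambda>h. h *\<^sub>R axis k 1)) (at t)"
    by (auto intro!: derivative_eq_intros)
  have "((\<lambda>t. f (y + t *\<^sub>R axis k 1)) has_derivative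
      (\<lambda>h. \<Sum>i\<in>UNIV. (h *\<^sub>R axis k 1) $ i * pd i f (y + t *\<^sub>R axis k 1))) (at t)"
    by (rule has_derivative_compose[OF d has_derivative_pd[OF assms]])
  moreover have "(\<Sum>i\<in>UNIV. (h *\<^sub>R axis k 1) $ i * pd i f (y + t *\<^sub>R axis k 1)) =
      pd k f (y + t *\<^sub>R axis k 1) * h" for h
    using sum_axis_mult[of k "\<lambda>i. pd i f (y + t *\<^sub>R axis k 1)"]
    by (simp add: mult.assoc sum_distrib_left[symmetric])
  ultimately show ?thesis
    by (simp add: has_field_derivative_def)
qed

lemma norm_scaled_axes_less:
  assumes "0 \<le> s" "s < r / 2" "0 \<le> t" "t < r / 2"
  shows "norm (s *\<^sub>R axis j 1 + t *\<^sub>R axis k (1::real) :: real^'n::finite) < r"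
  using norm_triangle_ineq[of "s *\<^sub>R axis j 1 :: real^'n" "t *\<^sub>R axis k 1"] assms
  by simp

text \<open>Two applications of the mean value theorem, first along axis \<open>j\<close> and then
  along axis \<open>k\<close>. The bound \<open>s < r / 2\<close> keeps all the points involved
  inside the ball, by the triangle inequality.\<close>

lemma second_difference_eq_pd_pd:
  fixes f :: "real^'n::finite \<Rightarrow> real"
  assumes S: "open S" "Ck_on 2 f S" and r: "ball x r \<subseteq> S" and s: "0 < s" "s < r / 2"
  obtains \<sigma> \<tau> where "0 < \<sigma>" "\<sigma> < s" "0 < \<tau>" "\<tau> < s"
    "f (x + s *\<^sub>R axis j 1 + s *\<^sub>R axis k 1) - f (x + s *\<^sub>R axis j 1) - f (x + s *\<^sub>R axis k 1) + f x =
     s * s * pd k (pd j f) (x + \<sigma> *\<^sub>R axis j 1 + \<tau> *\<^sub>R axis k 1)"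
proof -
  let ?e = "\<lambda>i::'n. axis i 1 :: real^'n"
  have in_S: "x + a *\<^sub>R ?e j + b *\<^sub>R ?e k \<in> S" if "0 \<le> a" "a \<le> s" "0 \<le> b" "b \<le> s" for a b
  proof -
    have "norm (a *\<^sub>R ?e j + b *\<^sub>R ?e k) < r"
      using that s by (intro norm_scaled_axes_less) auto
    then have "x + a *\<^sub>R ?e j + b *\<^sub>R ?e k \<in> ball x r"
      by (simp add: dist_norm norm_minus_commute algebra_simps)
    with r show ?thesis by blast
  qed
  have S1: "f differentiable_on S" "\<And>i. pd i f differentiable_on S"
    using S(2) by (simp_all add: numeral_2_eq_2)
  have df: "f differentiable (at y)" and dpf: "pd i f differentiable (at y)" if "y \<in> S" for y i
    using S1 that S(1) by (auto simp: differentiable_on_eq_differentiable_at)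
  \<comment> \<open>The increment of \<open>f\<close> over a step \<open>s\<close> along axis
    \<open>k\<close>, as a function of the displacement along axis \<open>j\<close>; the second
    difference is the increment of \<phi> over \<open>[0, s]\<close>.\<close>
  define \<phi> where "\<phi> = (\<lambda>\<sigma>. f (x + s *\<^sub>R ?e k + \<sigma> *\<^sub>R ?e j) - f (x + \<sigma> *\<^sub>R ?e j))"
  define \<phi>' where "\<phi>' = (\<lambda>\<sigma>. pd j f (x + s *\<^sub>R ?e k + \<sigma> *\<^sub>R ?e j) - pd j f (x + \<sigma> *\<^sub>R ?e j))"
  have "(\<phi> has_real_derivative \<phi>' \<sigma>) (at \<sigma>)" if "0 \<le> \<sigma>" "\<sigma> \<le> s" for \<sigma>
    unfolding \<phi>_def \<phi>'_def using in_S[of \<sigma> s] in_S[of \<sigma> 0] that s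
    by (intro DERIV_diff has_real_derivative_along_axis df) (auto simp: algebra_simps)
  then obtain \<sigma> where \<sigma>: "0 < \<sigma>" "\<sigma> < s" "\<phi> s - \<phi> 0 = (s - 0) * \<phi>' \<sigma>"
    using MVT2[OF s(1), of \<phi> \<phi>'] by auto
  have "((\<lambda>\<tau>. pd j f (x + \<sigma> *\<^sub>R ?e j + \<tau> *\<^sub>R ?e k)) has_real_derivative
      pd k (pd j f) (x + \<sigma> *\<^sub>R ?e j + \<tau> *\<^sub>R ?e k)) (at \<tau>)" if "0 \<le> \<tau>" "\<tau> \<le> s" for \<tau>
    using in_S[of \<sigma> \<tau>] that \<sigma>(1,2) by (intro has_real_derivative_along_axis dpf) auto
  then obtain \<tau> where \<tau>: "0 < \<tau>" "\<tau> < s"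
    "pd j f (x + \<sigma> *\<^sub>R ?e j + s *\<^sub>R ?e k) - pd j f (x + \<sigma> *\<^sub>R ?e j + 0 *\<^sub>R ?e k) =
     (s - 0) * pd k (pd j f) (x + \<sigma> *\<^sub>R ?e j + \<tau> *\<^sub>R ?e k)"
    using MVT2[OF s(1), of "\<lambda>\<tau>. pd j f (x + \<sigma> *\<^sub>R ?e j + \<tau> *\<^sub>R ?e k)"
        "\<lambda>\<tau>. pd k (pd j f) (x + \<sigma> *\<^sub>R ?e j + \<tau> *\<^sub>R ?e k)"] by blast
  have "\<phi>' \<sigma> = s * pd k (pd j f) (x + \<sigma> *\<^sub>R ?e j + \<tau> *\<^sub>R ?e k)"
    using \<tau>(3) by (simp add: \<phi>'_def algebra_simps)
  then have "\<phi> s - \<phi> 0 = s * s * pd k (pd j f) (x + \<sigma> *\<^sub>R ?e j + \<tau> *\<^sub>R ?e k)"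
    using \<sigma>(3) by simp
  then show ?thesis
    using that[OF \<sigma>(1,2) \<tau>(1,2)] by (simp add: \<phi>_def algebra_simps)
qed

text \<open>The second difference is symmetric in \<open>j\<close> and \<open>k\<close>, so the two
  mixed derivatives take a common value at two points arbitrarily close to \<open>x\<close>.
  Continuity then forbids different values at \<open>x\<close>.\<close>

lemma pd_commute:
  fixes f :: "real^'n::finite \<Rightarrow> real"
  assumes S: "open S" "Ck_on 2 f S" and x: "x \<in> S"
  shows "pd j (pd k f) x = pd k (pd j f) x"
proof (rule ccontr)
  assume neq: "pd j (pd k f) x \<noteq> pd k (pd j f) x"
  \<comment> \<open>Half the supposed gap: if both mixed derivatives move by less than
    \<open>e\<close>, they cannot meet.\<close>
  define e where "e = \<bar>pd j (pd k f) x - pd k (pd j f) x\<bar> / 2"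
  have "e > 0" using neq by (simp add: e_def)
  have "continuous (at x) (pd a (pd b f))" for a b
  proof -
    have "continuous_on S (pd a (pd b f))"
      using S(2) by (simp add: numeral_2_eq_2)
    then show ?thesis
      using S(1) x by (simp add: continuous_on_eq_continuous_at)
  qed
  then have "\<exists>d>0. \<forall>y. dist y x < d \<longrightarrow> dist (pd a (pd b f) y) (pd a (pd b f) x) < e" for a b
    using \<open>e > 0\<close> unfolding continuous_at_eps_delta by blast
  then obtain d where d: "\<And>a b. d a b > 0"
    "\<And>a b y. dist y x < d a b \<Longrightarrow> dist (pd a (pd b f) y) (pd a (pd b f) x) < e"
    by metis
  obtain r0 where r0: "r0 > 0" "ball x r0 \<subseteq> S"
    using S(1) x open_contains_ball by blast
  define r where "r = min r0 (min (d j k) (d k j))"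
  have r: "r > 0" "r \<le> r0" "r \<le> d j k" "r \<le> d k j"
    using r0 d by (auto simp: r_def)
  define s where "s = r / 4"
  have s: "0 < s" "s < r0 / 2" "s < r / 2"
    using r by (auto simp: s_def)
  obtain \<sigma> \<tau> where A: "0 < \<sigma>" "\<sigma> < s" "0 < \<tau>" "\<tau> < s"
    "f (x + s *\<^sub>R axis j 1 + s *\<^sub>R axis k 1) - f (x + s *\<^sub>R axis j 1) - f (x + s *\<^sub>R axis k 1) + f x =
     s * s * pd k (pd j f) (x + \<sigma> *\<^sub>R axis j 1 + \<tau> *\<^sub>R axis k 1)"
    by (rule second_difference_eq_pd_pd[OF S r0(2) s(1,2)])
  obtain \<sigma>' \<tau>' where B: "0 < \<sigma>'" "\<sigma>' < s" "0 < \<tau>'" "\<tau>' < s"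
    "f (x + s *\<^sub>R axis k 1 + s *\<^sub>R axis j 1) - f (x + s *\<^sub>R axis k 1) - f (x + s *\<^sub>R axis j 1) + f x =
     s * s * pd j (pd k f) (x + \<sigma>' *\<^sub>R axis k 1 + \<tau>' *\<^sub>R axis j 1)"
    by (rule second_difference_eq_pd_pd[OF S r0(2) s(1,2)])
  have "s * s * pd k (pd j f) (x + \<sigma> *\<^sub>R axis j 1 + \<tau> *\<^sub>R axis k 1) =
        s * s * pd j (pd k f) (x + \<sigma>' *\<^sub>R axis k 1 + \<tau>' *\<^sub>R axis j 1)"
    using A(5) B(5) by (simp add: algebra_simps)
  then have eq: "pd k (pd j f) (x + \<sigma> *\<^sub>R axis j 1 + \<tau> *\<^sub>R axis k 1) =
        pd j (pd k f) (x + \<sigma>' *\<^sub>R axis k 1 + \<tau>' *\<^sub>R axis j 1)"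
    using s(1) by simp
  have "norm (\<sigma> *\<^sub>R axis j 1 + \<tau> *\<^sub>R axis k 1 :: real^'n) < r"
       "norm (\<sigma>' *\<^sub>R axis k 1 + \<tau>' *\<^sub>R axis j 1 :: real^'n) < r"
    using A B s by (auto intro!: norm_scaled_axes_less)
  then have "dist (x + \<sigma> *\<^sub>R axis j 1 + \<tau> *\<^sub>R axis k 1) x < d k j"
       "dist (x + \<sigma>' *\<^sub>R axis k 1 + \<tau>' *\<^sub>R axis j 1) x < d j k"
    using r by (auto simp: dist_norm add.assoc)
  from d(2)[OF this(1)] d(2)[OF this(2)] eq show False
    by (simp add: e_def dist_real_def abs_if split: if_splits)
qed

section \<open>Smooth local inverses\<close>

text \<open>Bootstrapping: if \<open>g\<close> is of class \<open>m\<close>, then so are its partial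
  derivatives \<open>H i k (g y)\<close>, and \<open>g\<close> is of class \<open>m + 1\<close>. It
  serves to upgrade a merely differentiable inverse function.\<close>

lemma smooth_on_of_pd_compose:
  fixes g :: "real^'n::finite \<Rightarrow> real^'m::finite"
  assumes "open V" "open U" "g ` V \<subseteq> U"
    and diff: "\<And>i. (\<lambda>y. g y $ i) differentiable_on V"
    and H: "\<And>i k. smooth_on (H i k) U"
    and pd: "\<And>i k y. y \<in> V \<Longrightarrow> pd k (\<lambda>y. g y $ i) y = H i k (g y)"
  shows "smooth_on (\<lambda>y. g y $ i) V"
proof -
  have "Ck_on m (\<lambda>y. g y $ i) V" for m i
  proof (induction m arbitrary: i)
    case 0
    show ?case using differentiable_imp_continuous_on[OF diff] by simp
  next
    case (Suc m)
    have "Ck_on m (\<lambda>y. H i k (g y)) V" for k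
      by (rule Ck_on_compose[OF assms(1-3) _ Suc]) (use H in \<open>simp add: smooth_on_def\<close>)
    then have "Ck_on m (pd k (\<lambda>y. g y $ i)) V" for k
      by (rule Ck_on_cong[OF assms(1), rotated]) (simp add: pd)
    then show ?case using diff by simp
  qed
  then show ?thesis by (simp add: smooth_on_def)
qed

definition jacobian_matrix :: "(real^'n::finite \<Rightarrow> real^'n) \<Rightarrow> real^'n \<Rightarrow> real^'n^'n" where
  "jacobian_matrix R z = (\<chi> i j. pd j (\<lambda>z. R z $ i) z)"

lemma has_derivative_jacobian_matrix:
  fixes R :: "real^'n::finite \<Rightarrow> real^'n"
  assumes "open D" "\<And>i. smooth_on (\<lambda>z. R z $ i) D" "z \<in> D"
  shows "(R has_derivative (*v) (jacobian_matrix R z)) (at z)"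
proof -
  have "(R has_derivative (\<lambda>h. \<chi> i. \<Sum>k\<in>UNIV. h $ k * pd k (\<lambda>z. R z $ i) z)) (at z)"
    by (intro has_derivative_vec_lambda smooth_on_has_derivative[OF assms(1) _ assms(3)] assms(2))
  moreover have "(\<lambda>h. \<chi> i. \<Sum>k\<in>UNIV. h $ k * pd k (\<lambda>z. R z $ i) z) = (*v) (jacobian_matrix R z)"
    by (simp add: fun_eq_iff jacobian_matrix_def matrix_vector_mult_def vec_eq_iff mult.commute)
  ultimately show ?thesis by simp
qed

lemma smooth_on_det:
  fixes A :: "real^'m::finite \<Rightarrow> real^'n::finite^'n"
  assumes "open S" "\<And>i j. smooth_on (\<lambda>x. A x $ i $ j) S"
  shows "smooth_on (\<lambda>x. det (A x)) S"
  unfolding det_def by (intro smooth_on_intros assms)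

text \<open>The inverse function theorem gives a differentiable inverse \<open>g\<close> whose
  derivative at \<open>y\<close> is the inverse of the Jacobian at \<open>g y\<close>. By Cramer's
  rule its entries are smooth functions of \<open>g y\<close>, so bootstrapping makes
  \<open>g\<close> smooth.\<close>

lemma diffeo_on_local:
  fixes R :: "real^'n::finite \<Rightarrow> real^'n"
  assumes D: "open D" "z0 \<in> D" and sm: "\<And>i. smooth_on (\<lambda>z. R z $ i) D"
    and det: "det (jacobian_matrix R z0) \<noteq> 0"
  obtains U V where "z0 \<in> U" "U \<subseteq> D" "diffeo_on U V R"
proof -
  define R' where "R' = (\<lambda>z. Blinfun ((*v) (jacobian_matrix R z)))"
  have R': "blinfun_apply (R' z) = (*v) (jacobian_matrix R z)" for z
    unfolding R'_def by (rule bounded_linear_Blinfun_apply) simp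
  have smJ: "smooth_on (\<lambda>z. jacobian_matrix R z $ i $ j) D" for i j
    using smooth_on_pd[OF sm] by (simp add: jacobian_matrix_def)
  have "continuous_on D (\<lambda>z. \<chi> i. \<Sum>j\<in>UNIV. jacobian_matrix R z $ i $ j * h $ j)" for h
    by (intro continuous_on_vec_lambda continuous_intros smooth_on_imp_continuous_on smJ)
  then have "continuous_on D R'"
    by (intro continuous_on_blinfun_componentwise) (simp add: R' matrix_vector_mult_def)
  moreover have "(R has_derivative blinfun_apply (R' z)) (at z)" if "z \<in> D" for z
    unfolding R' by (rule has_derivative_jacobian_matrix[OF D(1) sm that])
  moreover obtain K where K: "K ** jacobian_matrix R z0 = mat 1"
    using det invertible_det_nz[of "jacobian_matrix R z0"] by (auto simp: invertible_def)
  have "Blinfun ((*v) K) o\<^sub>L R' z0 = id_blinfun"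
    by (rule blinfun_eqI)
       (simp add: R' bounded_linear_Blinfun_apply matrix_vector_mul_assoc K)
  ultimately obtain U V g g' where U: "open U" "U \<subseteq> D" "z0 \<in> U" and V: "open V"
    and hom: "homeomorphism U V R g"
    and g: "\<And>y. y \<in> V \<Longrightarrow> (g has_derivative (g' y)) (at y)"
      "\<And>y. y \<in> V \<Longrightarrow> g' y = inv (blinfun_apply (R' (g y)))"
      "\<And>y. y \<in> V \<Longrightarrow> bij (blinfun_apply (R' (g y)))"
    using inverse_function_theorem[OF D(1) _ _ D(2), of R R' "Blinfun ((*v) K)"] by metis
  have gV: "g ` V \<subseteq> U" "\<And>y. y \<in> V \<Longrightarrow> R (g y) = y" "\<And>z. z \<in> U \<Longrightarrow> g (R z) = z" "R ` U = V"
    using hom by (auto simp: homeomorphism_def)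
  have detg: "det (jacobian_matrix R (g y)) \<noteq> 0" if "y \<in> V" for y
  proof -
    have "inj ((*v) (jacobian_matrix R (g y)))"
      using g(3)[OF that] by (simp add: R' bij_is_inj)
    then show ?thesis
      using det_nz_iff_inj matrix_of_matrix_vector_mul[of "jacobian_matrix R (g y)"] 
        matrix_vector_mul_linear[of "jacobian_matrix R (g y)"] by metis
  qed
  define W where "W = {z\<in>U. det (jacobian_matrix R z) \<noteq> 0}"
  have contd: "continuous_on U (\<lambda>z. det (jacobian_matrix R z))"
    by (intro smooth_on_imp_continuous_on smooth_on_subset[OF _ U(2)] smooth_on_det[OF D(1)] smJ)
  have W: "open W"
    using continuous_open_preimage[OF contd U(1) open_Compl[OF closed_singleton[of 0]]]
    by (simp add: W_def vimage_def Int_def)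
  have gW: "g ` V \<subseteq> W"
    using gV(1) detg by (auto simp: W_def)
  \<comment> \<open>Cramer's rule for component \<open>i\<close> of the solution of
    \<open>jacobian_matrix R z *v x = axis k 1\<close>.\<close>
  define H where "H i k z =
      det (\<chi> a b. if b = i then axis k 1 $ a else jacobian_matrix R z $ a $ b) /
      det (jacobian_matrix R z)" for i k z
  have "W \<subseteq> D" using U(2) by (auto simp: W_def)
  have smH: "smooth_on (H i k) W" for i k
  proof -
    have sm1: "smooth_on (\<lambda>z. jacobian_matrix R z $ a $ b) W" for a b
      by (rule smooth_on_subset[OF smJ \<open>W \<subseteq> D\<close>])
    then have "smooth_on (\<lambda>z. (\<chi> a b. if b = i then axis k 1 $ a else jacobian_matrix R z $ a $ b) $ a $ b) W"
      for a b by (cases "b = i") (simp_all add: smooth_on_const W)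
    then show ?thesis
      unfolding H_def by (intro smooth_on_divide smooth_on_det sm1 W) (auto simp: W_def)
  qed
  have pdg: "pd k (\<lambda>y. g y $ i) y = H i k (g y)" if "y \<in> V" for i k y
  proof -
    have "jacobian_matrix R (g y) *v g' y (axis k 1) = axis k 1"
      using g(2,3)[OF that] by (simp add: R' bij_is_surj surj_f_inv_f)
    then have "g' y (axis k 1) $ i = H i k (g y)"
      unfolding H_def using cramer[OF detg[OF that]] by simp
    then show ?thesis
      using pd_eqI[OF has_derivative_vec_nth[OF g(1)[OF that]], of k i] by simp
  qed
  have "(\<lambda>y. g y $ i) differentiable_on V" for i
    using has_derivative_vec_nth[OF g(1)] V
    by (auto simp: differentiable_on_eq_differentiable_at differentiable_def)
  from smooth_on_of_pd_compose[OF V W gW this smH pdg]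
  have smg: "smooth_on (\<lambda>y. g y $ i) V" for i .
  have bij: "bij_betw R U V"
    unfolding bij_betw_def using gV(3,4) by (metis inj_onI)
  have "g y = inv_into U R y" if "y \<in> V" for y
    using gV that bij by (metis bij_betw_inv_into_left image_subset_iff)
  then have "smooth_on (\<lambda>y. inv_into U R y $ i) V" for i
    by (intro smooth_on_cong[OF V _ smg]) simp
  then have "diffeo_on U V R"
    unfolding diffeo_on_def using U V bij smooth_on_subset[OF sm U(2)] by auto
  with U that show ?thesis by blast
qed

section \<open>Characteristic speeds\<close>

text \<open>Divided differences: subtracting the equations at two roots and cancelling the
  difference of the roots lowers the degree. The case \<open>c3 = 0\<close> is included and shows
  that a quadratic polynomial with three distinct roots vanishes.\<close>

lemma cubic_vieta:
  fixes a b c :: "'a::idom"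
  assumes "a \<noteq> b" "a \<noteq> c" "b \<noteq> c"
    and "\<And>x. x \<in> {a, b, c} \<Longrightarrow> c3 * x ^ 3 + c2 * x ^ 2 + c1 * x + c0 = 0"
  shows "c2 = - c3 * (a + b + c)" "c1 = c3 * (a * b + a * c + b * c)" "c0 = - c3 * (a * b * c)"
proof -
  have A: "c3 * a ^ 3 + c2 * a ^ 2 + c1 * a + c0 = 0"
    and B: "c3 * b ^ 3 + c2 * b ^ 2 + c1 * b + c0 = 0"
    and C: "c3 * c ^ 3 + c2 * c ^ 2 + c1 * c + c0 = 0"
    using assms(4) by blast+
  have "(a - b) * (c3 * (a ^ 2 + a * b + b ^ 2) + c2 * (a + b) + c1) = 0"
    using A B by algebra
  then have AB: "c3 * (a ^ 2 + a * b + b ^ 2) + c2 * (a + b) + c1 = 0"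
    using assms(1) by simp
  have "(a - c) * (c3 * (a ^ 2 + a * c + c ^ 2) + c2 * (a + c) + c1) = 0"
    using A C by algebra
  then have AC: "c3 * (a ^ 2 + a * c + c ^ 2) + c2 * (a + c) + c1 = 0"
    using assms(2) by simp
  have "(b - c) * (c3 * (a + b + c) + c2) = 0"
    using AB AC by algebra
  then have "c3 * (a + b + c) + c2 = 0"
    using assms(3) by simp
  then show 2: "c2 = - c3 * (a + b + c)"
    by algebra
  show 1: "c1 = c3 * (a * b + a * c + b * c)"
    using AB 2 by algebra
  show "c0 = - c3 * (a * b * c)"
    using A 2 1 by algebra
qed

section \<open>The polynomials attached to a metric\<close>

definition metric_det :: "real^3 \<Rightarrow> real" where
  "metric_det z = z $ 1 * z $ 3 - (z $ 2)\<^sup>2"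

definition metric_det' :: "real^3 \<Rightarrow> real^3 \<Rightarrow> real" where
  "metric_det' z v = v $ 1 * z $ 3 + z $ 1 * v $ 3 - 2 * z $ 2 * v $ 2"

text \<open>This is the pairing of \<open>n(x)\<close> with \<open>z\<close>, that is, the metric
  evaluated on the vector \<open>(1, - x)\<close>.\<close>

definition quad_form :: "real \<Rightarrow> real^3 \<Rightarrow> real" where
  "quad_form x z = z $ 1 - 2 * x * z $ 2 + x\<^sup>2 * z $ 3"

text \<open>With the system written as \<open>A Z\<^sub>u + B Z\<^sub>v = 0\<close>, the determinant of \<open>x A + B\<close> is
  \<open>- 2 (E G - F\<^sup>2)\<close> times \<open>char_poly x z\<close>.\<close>

definition char_poly :: "real \<Rightarrow> real^3 \<Rightarrow> real" where
  "char_poly x z = x\<^sup>2 * (x - 2) * z $ 3 + x * (x + 1) * z $ 2 + (1 - 2 * x) * z $ 1"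

text \<open>The prime means the derivative in \<open>x\<close> here, whereas
  \<open>metric_det'\<close> is a derivative in \<open>z\<close>. As \<open>char_poly x\<close> is
  linear in \<open>z\<close>, it is its own derivative in that variable.\<close>

definition char_poly' :: "real \<Rightarrow> real^3 \<Rightarrow> real" where
  "char_poly' x z = (3 * x\<^sup>2 - 4 * x) * z $ 3 + (2 * x + 1) * z $ 2 - 2 * z $ 1"

definition invariant_form :: "real \<Rightarrow> real^3 \<Rightarrow> real^3 \<Rightarrow> real" where
  "invariant_form x z v =
     metric_det z * quad_form x v - 2 / 3 * quad_form x z * metric_det' z v"

lemma mem_metric_domain_iff: "z \<in> metric_domain \<longleftrightarrow> z $ 1 > 0 \<and> metric_det z > 0"
  by (simp add: metric_domain_def metric_det_def)

lemma open_metric_domain: "open metric_domain"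
  unfolding metric_domain_def
  by (intro open_Collect_conj open_Collect_less continuous_intros)

lemma metric_domain_pos:
  assumes "z \<in> metric_domain"
  shows "z $ 1 > 0" "z $ 3 > 0" "metric_det z > 0" "2 * \<bar>z $ 2\<bar> < z $ 1 + z $ 3"
proof -
  show 1: "z $ 1 > 0" "metric_det z > 0"
    using assms by (auto simp: mem_metric_domain_iff)
  have "z $ 1 * z $ 3 > 0"
    using 1(2) zero_le_power2[of "z $ 2"] unfolding metric_det_def by linarith
  then show 3: "z $ 3 > 0"
    using 1(1) zero_less_mult_pos by blast
  \<comment> \<open>The chain is \<open>4 F\<^sup>2 < 4 E G \<le> (E + G)\<^sup>2\<close>. The
    resulting bound on \<open>F\<close> controls the sign of the characteristic polynomial at 1 and
    far out.\<close>
  have "4 * (z $ 2)\<^sup>2 < (z $ 1 + z $ 3)\<^sup>2"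
    using 1(2) zero_le_power2[of "z $ 1 - z $ 3"]
    by (simp add: metric_det_def power2_eq_square algebra_simps)
  then have "(2 * \<bar>z $ 2\<bar>)\<^sup>2 < (z $ 1 + z $ 3)\<^sup>2"
    by (simp add: power_mult_distrib)
  then show "2 * \<bar>z $ 2\<bar> < z $ 1 + z $ 3"
    by (rule power2_less_imp_less) (use 1 3 in simp)
qed

lemma quad_form_pos:
  assumes "z \<in> metric_domain"
  shows "quad_form x z > 0"
proof -
  have "z $ 3 * quad_form x z = (x * z $ 3 - z $ 2)\<^sup>2 + metric_det z"
    by (simp add: quad_form_def metric_det_def power2_eq_square algebra_simps)
  moreover have "\<dots> > 0"
    using metric_domain_pos[OF assms] zero_le_power2[of "x * z $ 3 - z $ 2"] by linarith
  ultimately show ?thesis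
    using metric_domain_pos[OF assms] by (metis zero_less_mult_pos)
qed

section \<open>Existence and labelling of the three speeds\<close>

text \<open>Disjoint open intervals label the roots consistently over the whole domain, so that
  distinctness of the speeds is immediate and each speed can be followed continuously.\<close>

definition root_interval :: "3 \<Rightarrow> real set" where
  "root_interval i = (if i = 1 then {..<0} else if i = 2 then {0<..<1} else {1<..})"

definition char_speed :: "3 \<Rightarrow> real^3 \<Rightarrow> real" where
  "char_speed i z = (THE x. x \<in> root_interval i \<and> char_poly x z = 0)"

lemma open_root_interval: "open (root_interval i)"
  by (simp add: root_interval_def)

lemma root_interval_disjoint:
  "x \<in> root_interval i \<Longrightarrow> y \<in> root_interval j \<Longrightarrow> i \<noteq> j \<Longrightarrow> x \<noteq> y"
  using exhaust_3[of i] exhaust_3[of j] by (auto simp: root_interval_def split: if_splits)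

lemma root_interval_avoids: "x \<in> root_interval i \<Longrightarrow> x \<noteq> 0 \<and> x \<noteq> 1"
  by (auto simp: root_interval_def split: if_splits)

lemma IVT_sign_change:
  fixes f :: "real \<Rightarrow> real"
  assumes "a < b" "f a * f b < 0" "continuous_on {a..b} f"
  obtains x where "a < x" "x < b" "f x = 0"
proof -
  have "\<exists>x. a \<le> x \<and> x \<le> b \<and> f x = 0"
  proof (cases "f a \<le> 0")
    case True
    then have "0 \<le> f b" using assms(2) by (auto simp: mult_less_0_iff)
    with True show ?thesis using IVT'[of f a 0 b] assms by auto
  next
    case False
    then have "f b \<le> 0" using assms(2) by (auto simp: mult_less_0_iff)
    with False show ?thesis using IVT2'[of f b 0 a] assms by auto
  qed
  then obtain x where "a \<le> x" "x \<le> b" "f x = 0" by blast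
  moreover have "x \<noteq> a" "x \<noteq> b" using assms(2) \<open>f x = 0\<close> by auto
  ultimately show ?thesis using that[of x] by simp
qed

lemma continuous_on_char_poly: "continuous_on S (\<lambda>x. char_poly x z)"
  unfolding char_poly_def by (intro continuous_intros)

text \<open>Intermediate values between four points with alternating signs: 0 and 1, and explicit
  points \<open>m < 0\<close> and \<open>M > 1\<close> at which the cubic term dominates.\<close>

lemma ex_char_poly_roots:
  assumes "z \<in> metric_domain"
  shows "\<exists>x\<in>root_interval i. char_poly x z = 0"
proof -
  define E F G where "E = z $ 1" and "F = z $ 2" and "G = z $ 3"
  have pos: "E > 0" "G > 0" "2 * \<bar>F\<bar> < E + G"
    using metric_domain_pos[OF assms] by (auto simp: E_def F_def G_def)
  have p: "char_poly x z = x\<^sup>2 * (x - 2) * G + x * (x + 1) * F + (1 - 2 * x) * E" for x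
    by (simp add: char_poly_def E_def F_def G_def)
  have p0: "char_poly 0 z > 0" and p1: "char_poly 1 z < 0"
    using pos by (auto simp: p)
  \<comment> \<open>With \<open>\<bar>F\<bar> < (E + G) / 2\<close> the value at \<open>m\<close> is
    at most \<open>m\<^sup>2\<close> times a bracket linear in \<open>m\<close>; this choice turns
    the bracket into \<open>- (5 G + E) / 2\<close>.\<close>
  define m where "m = - 1 - 4 * E / G"
  have m: "m \<le> - 1" "G * m = - G - 4 * E"
    using pos by (auto simp: m_def field_simps)
  have "char_poly m z \<le> m\<^sup>2 * (m - 2) * G + m\<^sup>2 * ((E + G) / 2) + 3 * m\<^sup>2 * E"
  proof -
    have "m * (m + 1) * F \<le> m * (m + 1) * ((E + G) / 2)"
      using m pos by (intro mult_left_mono) (auto simp: mult_nonpos_nonpos)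
    also have "\<dots> \<le> m\<^sup>2 * ((E + G) / 2)"
      using m pos by (intro mult_right_mono) (auto simp: power2_eq_square algebra_simps)
    finally have "m * (m + 1) * F \<le> m\<^sup>2 * ((E + G) / 2)" .
    moreover have "(3 * m - 1) * (m + 1) \<ge> 0"
      using m by (intro mult_nonpos_nonpos) auto
    then have "(1 - 2 * m) * E \<le> 3 * m\<^sup>2 * E"
      using pos by (intro mult_right_mono) (auto simp: power2_eq_square algebra_simps)
    ultimately show ?thesis unfolding p by linarith
  qed
  also have "\<dots> = m\<^sup>2 * (G * m - 2 * G + (E + G) / 2 + 3 * E)"
    by (simp add: algebra_simps)
  also have "\<dots> < 0"
  proof (rule mult_pos_neg)
    show "G * m - 2 * G + (E + G) / 2 + 3 * E < 0"
      unfolding m(2) using pos(1,2) by (simp add: field_simps)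
  qed (use m in simp)
  finally have pm: "char_poly m z < 0" .
  \<comment> \<open>Likewise the value at \<open>M\<close> is at least \<open>M\<^sup>2\<close>
    times a bracket, which becomes \<open>(E + G) / 4\<close>. The bound \<open>M \<ge> 3\<close>
    serves to absorb the lower powers of \<open>M\<close> into \<open>M\<^sup>2\<close>.\<close>
  define M where "M = 3 + 2 * E / G"
  have M: "M \<ge> 3" "G * M = 3 * G + 2 * E"
    using pos by (auto simp: M_def field_simps)
  have "0 < M\<^sup>2 * (G * M - 2 * G - 3 / 4 * (E + G) - E)"
    unfolding M(2) using M(1) pos by (intro mult_pos_pos) (auto simp: algebra_simps)
  also have "\<dots> = M\<^sup>2 * (M - 2) * G - 3 / 2 * M\<^sup>2 * ((E + G) / 2) - M\<^sup>2 * E"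
    by (simp add: algebra_simps)
  also have "\<dots> \<le> char_poly M z"
  proof -
    have MM: "M * M \<ge> 3 * M"
      using M by (intro mult_right_mono) auto
    have "M * (M + 1) * (- F) \<le> M * (M + 1) * ((E + G) / 2)"
      using M pos by (intro mult_left_mono) auto
    also have "\<dots> \<le> 3 / 2 * M\<^sup>2 * ((E + G) / 2)"
      using MM M(1) pos(1,2) by (intro mult_right_mono) (auto simp: power2_eq_square algebra_simps)
    finally have "- 3 / 2 * M\<^sup>2 * ((E + G) / 2) \<le> M * (M + 1) * F"
      by simp
    moreover have "- M\<^sup>2 * E \<le> (1 - 2 * M) * E"
    proof (rule mult_right_mono)
      show "- M\<^sup>2 \<le> 1 - 2 * M"
        unfolding power2_eq_square using MM M(1) by linarith
    qed (use pos in simp)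
    ultimately show ?thesis unfolding p by linarith
  qed
  finally have pM: "char_poly M z > 0" .
  note IVT = IVT_sign_change[OF _ _ continuous_on_char_poly]
  show ?thesis
  proof (cases "i = 1 \<or> i = 2")
    case True
    moreover have "\<exists>x<0. char_poly x z = 0"
    proof (rule IVT[of m 0 z])
      show "m < 0" "char_poly m z * char_poly 0 z < 0"
        using m(1) pm p0 by (simp_all add: mult_neg_pos)
    qed blast
    moreover have "\<exists>x>0. x < 1 \<and> char_poly x z = 0"
    proof (rule IVT[of 0 1 z])
      show "(0::real) < 1" "char_poly 0 z * char_poly 1 z < 0"
        using p0 p1 by (simp_all add: mult_pos_neg)
    qed blast
    ultimately show ?thesis by (auto simp: root_interval_def)
  next
    case False
    have "\<exists>x>1. char_poly x z = 0"
    proof (rule IVT[of 1 M z])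
      show "1 < M" "char_poly 1 z * char_poly M z < 0"
        using M(1) pM p1 by (simp_all add: mult_neg_pos)
    qed blast
    with False show ?thesis by (auto simp: root_interval_def)
  qed
qed

text \<open>Stated for an arbitrary choice of roots \<open>x\<close>, because the factorization is
  what proves uniqueness of the roots and thus that the description in \<open>char_speed\<close> is
  proper.\<close>

lemma char_poly_factor:
  assumes "\<And>i. x i \<in> root_interval i" "\<And>i. char_poly (x i) z = 0"
  shows "z $ 2 - 2 * z $ 3 = - z $ 3 * (x 1 + x 2 + x 3)"
    "z $ 2 - 2 * z $ 1 = z $ 3 * (x 1 * x 2 + x 1 * x 3 + x 2 * x 3)"
    "z $ 1 = - z $ 3 * (x 1 * x 2 * x 3)"
    "char_poly y z = z $ 3 * ((y - x 1) * (y - x 2) * (y - x 3))"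
proof -
  have neq: "x 1 \<noteq> x 2" "x 1 \<noteq> x 3" "x 2 \<noteq> x 3"
    using root_interval_disjoint[OF assms(1) assms(1)] by auto
  have p: "char_poly y z = z $ 3 * y ^ 3 + (z $ 2 - 2 * z $ 3) * y ^ 2 + (z $ 2 - 2 * z $ 1) * y + z $ 1" for y
    by (simp add: char_poly_def power2_eq_square power3_eq_cube algebra_simps)
  have "z $ 3 * y ^ 3 + (z $ 2 - 2 * z $ 3) * y ^ 2 + (z $ 2 - 2 * z $ 1) * y + z $ 1 = 0"
    if "y \<in> {x 1, x 2, x 3}" for y
    using that assms(2) unfolding p[symmetric] by blast
  note v = cubic_vieta[OF neq this]
  show a: "z $ 2 - 2 * z $ 3 = - z $ 3 * (x 1 + x 2 + x 3)"
    by (rule v(1))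
  show b: "z $ 2 - 2 * z $ 1 = z $ 3 * (x 1 * x 2 + x 1 * x 3 + x 2 * x 3)"
    by (rule v(2))
  show c: "z $ 1 = - z $ 3 * (x 1 * x 2 * x 3)"
    by (rule v(3))
  show "char_poly y z = z $ 3 * ((y - x 1) * (y - x 2) * (y - x 3))"
    unfolding p a b by (subst c) (simp add: power2_eq_square power3_eq_cube algebra_simps)
qed

lemma char_speed:
  assumes "z \<in> metric_domain"
  shows "char_speed i z \<in> root_interval i" "char_poly (char_speed i z) z = 0"
    and char_speed_unique: "x \<in> root_interval i \<Longrightarrow> char_poly x z = 0 \<Longrightarrow> x = char_speed i z"
proof -
  obtain r where r: "\<And>i. r i \<in> root_interval i" "\<And>i. char_poly (r i) z = 0"
    using ex_char_poly_roots[OF assms] by metis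
  have uniq: "x = r i" if "x \<in> root_interval i" "char_poly x z = 0" for x i
  proof -
    have "(x - r 1) * (x - r 2) * (x - r 3) = 0"
      using char_poly_factor(4)[OF r, of x] that(2) metric_domain_pos(2)[OF assms] by simp
    then have "\<exists>j. x = r j" by auto
    then show ?thesis
      using root_interval_disjoint[OF that(1) r(1)] by metis
  qed
  have "char_speed i z = r i" for i
    unfolding char_speed_def by (rule the_equality) (use r uniq in auto)
  with r uniq show "char_speed i z \<in> root_interval i" "char_poly (char_speed i z) z = 0"
    "x \<in> root_interval i \<Longrightarrow> char_poly x z = 0 \<Longrightarrow> x = char_speed i z"
    by auto
qed

lemmas char_poly_factor_speed = char_poly_factor[of "\<lambda>i. char_speed i z" z for z, OF char_speed(1,2)]

lemma char_speed_distinct: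
  assumes "z \<in> metric_domain" "i \<noteq> j"
  shows "char_speed i z \<noteq> char_speed j z"
  using root_interval_disjoint[OF char_speed(1) char_speed(1)] assms by blast

text \<open>The roots are simple: differentiating the factorization gives three products, of which
  exactly one survives at a given root.\<close>

lemma char_poly'_char_speed:
  assumes "z \<in> metric_domain"
  shows "char_poly' (char_speed i z) z \<noteq> 0"
proof -
  let ?a = "char_speed 1 z" and ?b = "char_speed 2 z" and ?c = "char_speed 3 z"
  have p: "char_poly' y z = z $ 3 * ((y - ?a) * (y - ?b) + (y - ?a) * (y - ?c) + (y - ?b) * (y - ?c))" for y
  proof -
    have "char_poly' y z = 3 * y\<^sup>2 * z $ 3 + 2 * y * (z $ 2 - 2 * z $ 3) + (z $ 2 - 2 * z $ 1)"
      by (simp add: char_poly'_def algebra_simps)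
    then show ?thesis
      unfolding char_poly_factor_speed(1,2)[OF assms assms]
      by (simp add: power2_eq_square algebra_simps)
  qed
  have "?a \<noteq> ?b" "?a \<noteq> ?c" "?b \<noteq> ?c"
    by (simp_all add: char_speed_distinct[OF assms])
  with p show ?thesis
    using exhaust_3[of i] metric_domain_pos(2)[OF assms] by auto
qed

section \<open>Smooth dependence of the speeds on the metric\<close>

text \<open>A small interval around the root, inside \<open>root_interval i\<close>, sees a sign
  change of the polynomial. The sign change is an open condition on the metric, and a root it
  produces lies in the right interval, hence is the speed with the same index.\<close>

lemma continuous_at_char_speed:
  assumes z: "z \<in> metric_domain"
  shows "continuous (at z) (char_speed i)"
  unfolding continuous_at_eps_delta
proof (intro allI impI)
  fix e :: real assume "e > 0"
  let ?x = "char_speed i z"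
  obtain d0 where d0: "d0 > 0" "cball ?x d0 \<subseteq> root_interval i"
    using open_root_interval[of i] char_speed(1)[OF z, of i] open_contains_cball by blast
  define d where "d = min e d0"
  have d: "d > 0" "d \<le> e" "{?x - d..?x + d} \<subseteq> root_interval i"
    using d0 \<open>e > 0\<close> by (auto simp: d_def subset_iff dist_real_def)
  have ne: "?x \<noteq> ?x - d" "?x \<noteq> ?x + d" using d by auto
  \<comment> \<open>The other two roots lie outside the interval, so their linear factors do not
    change sign between its ends; only the factor of root \<open>i\<close> does.\<close>
  have out: "(?x - d - char_speed j z) * (?x + d - char_speed j z) > 0" if "j \<noteq> i" for j
  proof -
    have "char_speed j z \<notin> {?x - d..?x + d}"
      using root_interval_disjoint[OF _ char_speed(1)[OF z, of j]] d(3) that by blast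
    with d(1) show ?thesis
      by (auto simp: zero_less_mult_iff)
  qed
  obtain j k where jk: "j \<noteq> i" "k \<noteq> i"
    "\<And>y. char_poly y z = z $ 3 * ((y - char_speed i z) * ((y - char_speed j z) * (y - char_speed k z)))"
  proof -
    note f = char_poly_factor_speed(4)[OF z z]
    consider "i = 1" | "i = 2" | "i = 3" using exhaust_3[of i] by blast
    then show ?thesis
    proof cases
      case 1
      show ?thesis by (rule that[of 2 3]) (simp_all only: 1 f mult.assoc, simp_all)
    next
      case 2
      show ?thesis by (rule that[of 1 3]) (simp_all only: 2 f mult_ac, simp_all)
    next
      case 3
      show ?thesis by (rule that[of 1 2]) (simp_all only: 3 f mult_ac, simp_all)
    qed
  qed
  have "char_poly (?x - d) z * char_poly (?x + d) z =
     - ((z $ 3)\<^sup>2 * d\<^sup>2 * (((?x - d - char_speed j z) * (?x + d - char_speed j z)) *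
       ((?x - d - char_speed k z) * (?x + d - char_speed k z))))"
    unfolding jk(3) by (simp add: power2_eq_square)
  also have "\<dots> < 0"
    using out[OF jk(1)] out[OF jk(2)] d(1) metric_domain_pos(2)[OF z] by simp
  finally have neg: "char_poly (?x - d) z * char_poly (?x + d) z < 0" .
  have "open {y \<in> metric_domain. char_poly (?x - d) y * char_poly (?x + d) y < 0}"
    unfolding Collect_conj_eq Collect_mem_eq char_poly_def
    by (intro open_Int open_metric_domain open_Collect_less continuous_intros)
  then obtain \<delta> where \<delta>: "\<delta> > 0"
    "ball z \<delta> \<subseteq> {y \<in> metric_domain. char_poly (?x - d) y * char_poly (?x + d) y < 0}"
    using neg z open_contains_ball by (metis (no_types, lifting) mem_Collect_eq)
  have "dist (char_speed i y) ?x < e" if "dist y z < \<delta>" for y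
  proof -
    have y: "y \<in> metric_domain" "char_poly (?x - d) y * char_poly (?x + d) y < 0"
      using subsetD[OF \<delta>(2), of y] that by (simp_all add: dist_commute)
    obtain x where x: "?x - d < x" "x < ?x + d" "char_poly x y = 0"
      using IVT_sign_change[OF _ y(2) continuous_on_char_poly] d(1) by auto
    then have "x = char_speed i y"
      using d(3) by (intro char_speed_unique[OF y(1)]) auto
    with x d(2) show ?thesis by (auto simp: dist_real_def)
  qed
  with \<delta>(1) show "\<exists>d>0. \<forall>y. dist y z < d \<longrightarrow> dist (char_speed i y) ?x < e" by blast
qed

text \<open>A product rule with one factor merely continuous. It works because \<open>h\<close>
  vanishes at \<open>x\<close>: the term with the increment of \<open>q\<close> carries the factor
  \<open>h' (y - x)\<close>, which is of order \<open>norm (y - x)\<close>.\<close>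

lemma has_derivative_mult_vanishing:
  fixes h q :: "'a::real_normed_vector \<Rightarrow> real"
  assumes h: "(h has_derivative h') (at x)" "h x = 0" and q: "continuous (at x) q"
  shows "((\<lambda>y. h y * q y) has_derivative (\<lambda>v. h' v * q x)) (at x)"
proof -
  have bl: "bounded_linear h'" using h(1) by (rule has_derivative_bounded_linear)
  obtain K where K: "\<And>v. norm (h' v) \<le> norm v * K"
    using bounded_linear.bounded[OF bl] by blast
  have q0: "((\<lambda>y. q y - q x) \<longlongrightarrow> 0) (at x)"
    using q by (simp add: continuous_within LIM_zero)
  have "((\<lambda>y. h' (y - x) / norm (y - x) * (q y - q x)) \<longlongrightarrow> 0) (at x)"
  proof (rule Lim_null_comparison)
    have "norm (h' (y - x) / norm (y - x) * (q y - q x)) \<le> \<bar>K\<bar> * \<bar>q y - q x\<bar>" if "y \<noteq> x" for y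
    proof -
      have "norm (h' (y - x)) \<le> norm (y - x) * \<bar>K\<bar>"
        using K[of "y - x"] by (meson abs_ge_self mult_left_mono norm_ge_zero order_trans)
      then have "\<bar>h' (y - x)\<bar> / norm (y - x) \<le> \<bar>K\<bar>"
        using that by (simp add: field_simps)
      from mult_right_mono[OF this, of "\<bar>q y - q x\<bar>"] show ?thesis
        by (simp add: abs_mult)
    qed
    then show "\<forall>\<^sub>F y in at x. norm (h' (y - x) / norm (y - x) * (q y - q x)) \<le> \<bar>K\<bar> * \<bar>q y - q x\<bar>"
      by (auto simp: eventually_at_filter)
    show "((\<lambda>y. \<bar>K\<bar> * \<bar>q y - q x\<bar>) \<longlongrightarrow> 0) (at x)"
      using tendsto_mult_right_zero[OF tendsto_rabs_zero[OF q0], of "\<bar>K\<bar>"] by simp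
  qed
  moreover have "((\<lambda>y. (h y - h x - h' (y - x)) / norm (y - x) * q y) \<longlongrightarrow> 0 * q x) (at x)"
  proof (rule tendsto_mult)
    show "((\<lambda>y. (h y - h x - h' (y - x)) / norm (y - x)) \<longlongrightarrow> 0) (at x)"
      using h(1) unfolding has_derivative_within by (simp add: diff_diff_eq)
    show "(q \<longlongrightarrow> q x) (at x)"
      using q by (simp add: continuous_within)
  qed
  ultimately have "((\<lambda>y. (h y - h x - h' (y - x)) / norm (y - x) * q y +
      h' (y - x) / norm (y - x) * (q y - q x)) \<longlongrightarrow> 0) (at x)"
    using tendsto_add by fastforce
  moreover have "(h y - h x - h' (y - x)) / norm (y - x) * q y +
      h' (y - x) / norm (y - x) * (q y - q x) =
      (1 / norm (y - x)) *\<^sub>R (h y * q y - (h x * q x + h' (y - x) * q x))" for y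
    using h(2) by (cases "y = x") (simp_all add: field_simps)
  ultimately show ?thesis
    unfolding has_derivative_within
    using bounded_linear_compose[OF bounded_linear_mult_left bl] by simp
qed

lemma char_poly_diff_eq:
  "char_poly x z - char_poly y z =
     (x - y) * ((x\<^sup>2 + x * y + y\<^sup>2 - 2 * (x + y)) * z $ 3 + (x + y + 1) * z $ 2 - 2 * z $ 1)"
  by (simp add: char_poly_def power2_eq_square algebra_simps)

lemma has_derivative_char_poly: "(char_poly x has_derivative char_poly x) (at z)"
  unfolding char_poly_def
  by (auto intro!: derivative_eq_intros has_derivative_vec_nth[OF has_derivative_ident])

lemma has_derivative_char_speed:
  assumes z: "z \<in> metric_domain"
  shows "(char_speed i has_derivative
    (\<lambda>v. - char_poly (char_speed i z) v / char_poly' (char_speed i z) z)) (at z)"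
proof -
  define x where "x = char_speed i z"
  define s where "s = (\<lambda>y. ((char_speed i y)\<^sup>2 + char_speed i y * x + x\<^sup>2 - 2 * (char_speed i y + x)) * y $ 3
      + (char_speed i y + x + 1) * y $ 2 - 2 * y $ 1)"
  have sz: "s z = char_poly' x z"
    by (simp add: s_def x_def char_poly'_def power2_eq_square algebra_simps)
  then have nz: "s z \<noteq> 0"
    using char_poly'_char_speed[OF z] by (simp add: x_def)
  have cont: "continuous (at z) s"
    unfolding s_def by (intro continuous_intros continuous_at_char_speed z)
  then have "continuous (at z) (\<lambda>y. inverse (s y))"
    using nz by (intro continuous_at_within_inverse)
  moreover have "((\<lambda>y. - char_poly x y) has_derivative (\<lambda>v. - char_poly x v)) (at z)"
    by (intro has_derivative_minus has_derivative_char_poly)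
  ultimately have "((\<lambda>y. - char_poly x y * inverse (s y)) has_derivative
      (\<lambda>v. - char_poly x v * inverse (s z))) (at z)"
    using char_speed(2)[OF z] by (intro has_derivative_mult_vanishing) (simp_all add: x_def)
  then have der: "((\<lambda>y. x + - char_poly x y * inverse (s y)) has_derivative
      (\<lambda>v. 0 + - char_poly x v * inverse (s z))) (at z)"
    by (intro has_derivative_add has_derivative_const)
  have "\<forall>\<^sub>F y in nhds z. y \<in> metric_domain"
    by (rule eventually_nhds_in_open[OF open_metric_domain z])
  moreover have "\<forall>\<^sub>F y in nhds z. s y \<noteq> 0"
    using tendsto_imp_eventually_ne[of s "s z" "nhds z" 0] cont nz
    by (simp add: continuous_at tendsto_nhds_iff)
  ultimately have ev: "\<forall>\<^sub>F y in nhds z. x + - char_poly x y * inverse (s y) = char_speed i y"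
  proof eventually_elim
    case (elim y)
    have "- char_poly x y = (char_speed i y - x) * s y"
      using char_poly_diff_eq[of "char_speed i y" y x] char_speed(2)[OF elim(1), of i]
      by (simp add: s_def)
    then show ?case
      using elim(2) by (simp add: mult.assoc)
  qed
  have "(char_speed i has_derivative (\<lambda>v. 0 + - char_poly x v * inverse (s z))) (at z)"
    by (rule has_derivative_transform_eventually[OF der])
       (use ev eventually_nhds_x_imp_x[OF ev] in \<open>auto simp: eventually_at_filter elim: eventually_mono\<close>)
  then show ?thesis
    by (simp add: sz x_def divide_inverse)
qed

text \<open>Bootstrapping again: the derivative is a rational function of the speed and the metric,
  with nonvanishing denominator because the roots are simple.\<close>

lemma smooth_on_char_speed: "smooth_on (char_speed i) metric_domain"
proof -
  have "Ck_on m (char_speed i) metric_domain" for m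
  proof (induction m)
    case 0
    then show ?case
      by (simp add: continuous_at_imp_continuous_on continuous_at_char_speed)
  next
    case (Suc m)
    have "Ck_on m (\<lambda>z. - char_poly (char_speed i z) v / char_poly' (char_speed i z) z) metric_domain" for v
    proof -
      note intros = Ck_on_diff Ck_on_add Ck_on_mult Ck_on_power Ck_on_const Ck_on_nth Suc open_metric_domain
      have "Ck_on m (\<lambda>z. 0 - char_poly (char_speed i z) v) metric_domain"
        unfolding char_poly_def by (intro intros)
      moreover have "Ck_on m (\<lambda>z. char_poly' (char_speed i z) z) metric_domain"
        unfolding char_poly'_def by (intro intros)
      ultimately have "Ck_on m (\<lambda>z. (0 - char_poly (char_speed i z) v) / char_poly' (char_speed i z) z) metric_domain"
        by (intro Ck_on_divide open_metric_domain char_poly'_char_speed)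
      then show ?thesis by simp
    qed
    then show ?case
      by (intro Ck_on_SucI[OF open_metric_domain has_derivative_char_speed]) auto
  qed
  then show ?thesis by (simp add: smooth_on_def)
qed

section \<open>Riemann invariants\<close>

lemma quad_form_add: "quad_form x (v + w) = quad_form x v + quad_form x w"
  and quad_form_diff: "quad_form x (v - w) = quad_form x v - quad_form x w"
  and quad_form_scaleR: "quad_form x (c *\<^sub>R v) = c * quad_form x v"
  by (simp_all add: quad_form_def algebra_simps)

lemma quad_form_eq_0_imp:
  assumes "a \<noteq> b" "a \<noteq> c" "b \<noteq> c" "quad_form a v = 0" "quad_form b v = 0" "quad_form c v = 0"
  shows "v = 0"
proof -
  have "0 * x ^ 3 + v $ 3 * x\<^sup>2 + (- 2 * v $ 2) * x + v $ 1 = 0" if "x \<in> {a, b, c}" for x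
    using that assms(4-6) by (auto simp: quad_form_def algebra_simps)
  from cubic_vieta[OF assms(1-3) this] show ?thesis
    by (simp add: vec_eq_iff forall_3)
qed

lemma invariant_form_eq_quad_form:
  "invariant_form x z v = quad_form x (metric_det z *\<^sub>R v - (2 / 3 * metric_det' z v) *\<^sub>R z)"
  by (simp add: invariant_form_def quad_form_diff quad_form_scaleR)

text \<open>Injectivity of the derivative of \<psi>. Apply \<open>metric_det' z\<close> to the
  equation: since \<open>metric_det' z z = 2 * metric_det z\<close>, this yields
  \<open>D d = 4/3 D d\<close> with \<open>d = metric_det' z v\<close>, so \<open>d = 0\<close>, and
  then \<open>v = 0\<close>.\<close>

lemma metric_det_eq_0_imp:
  assumes "metric_det z \<noteq> 0" "metric_det z *\<^sub>R v - (2 / 3 * metric_det' z v) *\<^sub>R z = 0"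
  shows "v = 0"
proof -
  have v: "metric_det z * v $ i = 2 / 3 * metric_det' z v * z $ i" for i
    using arg_cong[OF assms(2), of "\<lambda>w. w $ i"] by simp
  have "metric_det z * metric_det' z v =
      (metric_det z * v $ 1) * z $ 3 + z $ 1 * (metric_det z * v $ 3) - 2 * z $ 2 * (metric_det z * v $ 2)"
    by (simp add: metric_det'_def algebra_simps)
  also have "\<dots> = 4 / 3 * metric_det' z v * metric_det z"
    unfolding v by (simp add: metric_det_def power2_eq_square algebra_simps)
  finally have "metric_det' z v = 0"
    using assms(1) by simp
  with v assms(1) show ?thesis by (simp add: vec_eq_iff)
qed

lemma invariant_form_nondegenerate:
  assumes z: "z \<in> metric_domain" and v: "\<And>i. invariant_form (char_speed i z) z v = 0"
  shows "v = 0"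
proof (rule metric_det_eq_0_imp)
  show "metric_det z \<noteq> 0" using metric_domain_pos(3)[OF z] by simp
  show "metric_det z *\<^sub>R v - (2 / 3 * metric_det' z v) *\<^sub>R z = 0"
    using v char_speed_distinct[OF z, of 1 2] char_speed_distinct[OF z, of 1 3]
      char_speed_distinct[OF z, of 2 3] unfolding invariant_form_eq_quad_form
    by (intro quad_form_eq_0_imp[of "char_speed 1 z" "char_speed 2 z" "char_speed 3 z"]) auto
qed

text \<open>The right-hand side says that the cubic polynomial
  \<open>x \<mapsto> invariant_form x z p - x * invariant_form x z q\<close> is a multiple of \<open>x \<mapsto> char_poly x z\<close>, where
  \<open>z = (E, F, G)\<close>, \<open>p = (e, f, g)\<close> and \<open>q = (e', f', g')\<close>.\<close>

lemma system_iff_proportional: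
  fixes E F G e f g e' f' g' :: real
  defines "D \<equiv> E * G - F\<^sup>2" and "d \<equiv> e * G + E * g - 2 * F * f" and "d' \<equiv> e' * G + E * g' - 2 * F * f'"
  assumes "G > 0" "D > 0"
  shows "(2 * E * f - F * e - E * e' = 0 \<and> 2 * G * f' - F * g' - G * g = 0 \<and>
      G * e + E * g' - 2 * F * (f + f') + (3 * F - 2 * G) * e' + (3 * F - 2 * E) * g = 0) \<longleftrightarrow>
    (G * (D * e - 2 / 3 * d * E) = - (D * g' - 2 / 3 * d' * G) * E \<and>
     G * (2 * (D * f - 2 / 3 * d * F) + (D * e' - 2 / 3 * d' * E)) = (D * g' - 2 / 3 * d' * G) * (F - 2 * E) \<and>
     G * ((D * g - 2 / 3 * d * G) + 2 * (D * f' - 2 / 3 * d' * F)) = - (D * g' - 2 / 3 * d' * G) * (F - 2 * G))"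
    (is "?S \<longleftrightarrow> ?T")
proof -
  define S1 S2 S3 where "S1 = 2 * E * f - F * e - E * e'" and "S2 = 2 * G * f' - F * g' - G * g"
    and "S3 = G * e + E * g' - 2 * F * (f + f') + (3 * F - 2 * G) * e' + (3 * F - 2 * E) * g"
  define T0 T1 T2 where
    "T0 = G * (D * e - 2 / 3 * d * E) + (D * g' - 2 / 3 * d' * G) * E" and
    "T1 = G * (2 * (D * f - 2 / 3 * d * F) + (D * e' - 2 / 3 * d' * E)) - (D * g' - 2 / 3 * d' * G) * (F - 2 * E)" and
    "T2 = G * ((D * g - 2 / 3 * d * G) + 2 * (D * f' - 2 / 3 * d' * F)) + (D * g' - 2 / 3 * d' * G) * (F - 2 * G)"
  note defs = S1_def S2_def S3_def T0_def T1_def T2_def D_def d_def d'_def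
  \<comment> \<open>The coefficient conditions are explicit linear combinations of the three
    equations; the converse inverts this linear map.\<close>
  have T0: "3 * T0 = 3 * F * G * S1 + 3 * E * F * S2 + E * G * S3"
    unfolding defs by (simp add: field_simps power2_eq_square)
  have T1: "3 * T1 = 3 * G\<^sup>2 * S1 + (6 * E * F - 3 * F\<^sup>2) * S2 - F * G * S3"
    unfolding defs by (simp add: field_simps power2_eq_square)
  have T2: "3 * T2 = (3 * F\<^sup>2 + 3 * E * G - 6 * F * G) * S2 - 2 * G\<^sup>2 * S3"
    unfolding defs by (simp add: field_simps power2_eq_square)
  have "S1 = 0 \<and> S2 = 0 \<and> S3 = 0 \<longleftrightarrow> T0 = 0 \<and> T1 = 0 \<and> T2 = 0"
  proof
    assume "S1 = 0 \<and> S2 = 0 \<and> S3 = 0"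
    with T0 T1 T2 show "T0 = 0 \<and> T1 = 0 \<and> T2 = 0" by simp
  next
    assume T: "T0 = 0 \<and> T1 = 0 \<and> T2 = 0"
    \<comment> \<open>\<open>S1\<close> is eliminated by
      \<open>G * (3 * T0) - F * (3 * T1)\<close>.\<close>
    have A: "3 * F * (E * G - 2 * E * F + F\<^sup>2) * S2 + G * (E * G + F\<^sup>2) * S3 = 0"
      using T0 T1 T by algebra
    have B: "(3 * F\<^sup>2 + 3 * E * G - 6 * F * G) * S2 - 2 * G\<^sup>2 * S3 = 0"
      using T2 T by simp
    \<comment> \<open>Eliminating \<open>S3\<close> via
      \<open>2 * G * A + (E * G + F\<^sup>2) * B\<close> leaves
      \<open>3 * D\<^sup>2 * S2\<close>.\<close>
    have "G * D\<^sup>2 * S2 = 0"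
      using A B unfolding D_def by algebra
    then have 2: "S2 = 0" using assms(4,5) by simp
    then have 3: "S3 = 0" using B assms(4) by simp
    then have 1: "S1 = 0" using T1 T 2 assms(4) by simp
    from 1 2 3 show "S1 = 0 \<and> S2 = 0 \<and> S3 = 0" by simp
  qed
  then show ?thesis
    unfolding S1_def S2_def S3_def T0_def T1_def T2_def by (simp only: mult_minus_left eq_neg_iff_add_eq_0 right_minus_eq)
qed

text \<open>Here \<open>p\<close> and \<open>q\<close> stand for the derivatives of the metric in
  \<open>u\<close> and \<open>v\<close>. Vanishing of a cubic at the three distinct speeds means
  proportionality to \<open>char_poly\<close>, and comparing coefficients gives the system.\<close>

lemma system_iff_invariant_form:
  fixes p q :: "real^3"
  assumes z: "z \<in> metric_domain"
  shows "(2 * z $ 1 * p $ 2 - z $ 2 * p $ 1 - z $ 1 * q $ 1 = 0 \<and>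
      2 * z $ 3 * q $ 2 - z $ 2 * q $ 3 - z $ 3 * p $ 3 = 0 \<and>
      z $ 3 * p $ 1 + z $ 1 * q $ 3 - 2 * z $ 2 * (p $ 2 + q $ 2) + (3 * z $ 2 - 2 * z $ 3) * q $ 1
        + (3 * z $ 2 - 2 * z $ 1) * p $ 3 = 0) \<longleftrightarrow>
    (\<forall>i. invariant_form (char_speed i z) z p = char_speed i z * invariant_form (char_speed i z) z q)"
proof -
  define U V where "U = metric_det z *\<^sub>R p - (2 / 3 * metric_det' z p) *\<^sub>R z"
    and "V = metric_det z *\<^sub>R q - (2 / 3 * metric_det' z q) *\<^sub>R z"
  let ?x = "\<lambda>i. char_speed i z"
  have neq: "?x 1 \<noteq> ?x 2" "?x 1 \<noteq> ?x 3" "?x 2 \<noteq> ?x 3"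
    by (simp_all add: char_speed_distinct[OF z])
  note f = char_poly_factor_speed[OF z z]
  have G: "z $ 3 > 0" "metric_det z > 0" using metric_domain_pos[OF z] by auto
  have cubic: "invariant_form y z p - y * invariant_form y z q =
      (- V $ 3) * y ^ 3 + (U $ 3 + 2 * V $ 2) * y\<^sup>2 + (- 2 * U $ 2 - V $ 1) * y + U $ 1" for y
    unfolding invariant_form_eq_quad_form U_def[symmetric] V_def[symmetric]
    by (simp add: quad_form_def power2_eq_square power3_eq_cube algebra_simps)
  have proportional: "(\<forall>i. invariant_form (?x i) z p = ?x i * invariant_form (?x i) z q) \<longleftrightarrow>
    (z $ 3 * U $ 1 = - V $ 3 * z $ 1 \<and> z $ 3 * (2 * U $ 2 + V $ 1) = V $ 3 * (z $ 2 - 2 * z $ 1) \<and>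
     z $ 3 * (U $ 3 + 2 * V $ 2) = - V $ 3 * (z $ 2 - 2 * z $ 3))" (is "?L \<longleftrightarrow> ?R")
  proof
    assume L: ?L
    have "(- V $ 3) * y ^ 3 + (U $ 3 + 2 * V $ 2) * y\<^sup>2 + (- 2 * U $ 2 - V $ 1) * y + U $ 1 = 0"
      if "y \<in> {?x 1, ?x 2, ?x 3}" for y
      using that L unfolding cubic[symmetric] by auto
    note v = cubic_vieta[OF neq this]
    have "z $ 3 * U $ 1 = - V $ 3 * z $ 1"
      using v(3) f(3) by algebra
    moreover have "z $ 3 * (2 * U $ 2 + V $ 1) = V $ 3 * (z $ 2 - 2 * z $ 1)"
      using v(2) f(2) by algebra
    moreover have "z $ 3 * (U $ 3 + 2 * V $ 2) = - V $ 3 * (z $ 2 - 2 * z $ 3)"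
      using v(1) f(1) by algebra
    ultimately show ?R by blast
  next
    assume R: ?R
    then have R1: "z $ 3 * U $ 1 = - V $ 3 * z $ 1"
      and R2: "z $ 3 * (2 * U $ 2 + V $ 1) = V $ 3 * (z $ 2 - 2 * z $ 1)"
      and R3: "z $ 3 * (U $ 3 + 2 * V $ 2) = - V $ 3 * (z $ 2 - 2 * z $ 3)"
      by blast+
    \<comment> \<open>Comparison of leading coefficients, \<open>- V $ 3\<close> against
      \<open>z $ 3\<close>, fixes the factor of proportionality.\<close>
    have "z $ 3 * (invariant_form y z p - y * invariant_form y z q) = - V $ 3 * char_poly y z" for y
    proof -
      have "z $ 3 * (invariant_form y z p - y * invariant_form y z q) = (- V $ 3) * z $ 3 * y ^ 3 +
          (z $ 3 * (U $ 3 + 2 * V $ 2)) * y\<^sup>2 - (z $ 3 * (2 * U $ 2 + V $ 1)) * y + z $ 3 * U $ 1"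
        unfolding cubic by (simp add: algebra_simps)
      also have "\<dots> = - V $ 3 * char_poly y z"
        unfolding R1 R2 R3 by (simp add: char_poly_def power2_eq_square power3_eq_cube algebra_simps)
      finally show ?thesis .
    qed
    then have "z $ 3 * (invariant_form (?x i) z p - ?x i * invariant_form (?x i) z q) = 0" for i
      using char_speed(2)[OF z] by simp
    then show ?L using G by simp
  qed
  show ?thesis
    unfolding proportional U_def V_def
    using system_iff_proportional[of "z $ 3" "z $ 1" "z $ 2" "p $ 2" "p $ 1" "q $ 1" "q $ 2" "q $ 3" "p $ 3"] G
    unfolding metric_det_def metric_det'_def
    by (simp add: mult.commute mult.left_commute)
qed

section \<open>Critical values and the diagonal form\<close>

text \<open>The cube of the critical value. Cubing avoids fractional powers of
  \<open>x (1 - x)\<close>, which is negative for the first and third speed.\<close>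

definition riemann_invariant :: "3 \<Rightarrow> real^3 \<Rightarrow> real" where
  "riemann_invariant i z = (quad_form (char_speed i z) z) ^ 3 /
     ((metric_det z)\<^sup>2 * (char_speed i z * (1 - char_speed i z))\<^sup>2)"

lemma has_derivative_cube_div:
  fixes N D s :: "'a::real_normed_vector \<Rightarrow> real"
  assumes "(N has_derivative N') (at z)" "(D has_derivative D') (at z)" "(s has_derivative s') (at z)"
    and "D z \<noteq> 0" "s z \<noteq> 0"
  shows "((\<lambda>y. N y ^ 3 / ((D y)\<^sup>2 * (s y)\<^sup>2)) has_derivative
    (\<lambda>v. (N z)\<^sup>2 * (3 * N' v * D z * s z - 2 * N z * (D' v * s z + D z * s' v)) / ((D z) ^ 3 * (s z) ^ 3)))
    (at z)"
  using assms(4,5)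
  by (auto intro!: derivative_eq_intros assms(1-3) simp: fun_eq_iff field_simps power2_eq_square power3_eq_cube)

text \<open>An envelope argument: the speed is a critical point in \<open>x\<close>, so its own
  variation \<open>L\<close> drops out, and only the derivative with \<open>x\<close> fixed
  remains.\<close>

lemma has_derivative_riemann_invariant:
  assumes z: "z \<in> metric_domain"
  obtains \<rho> where "\<rho> \<noteq> 0"
    "(riemann_invariant i has_derivative (\<lambda>v. \<rho> * invariant_form (char_speed i z) z v)) (at z)"
proof -
  define x where "x = char_speed i z"
  define L where "L = (\<lambda>v. - char_poly x v / char_poly' x z)"
  have L: "(char_speed i has_derivative L) (at z)"
    unfolding L_def x_def by (rule has_derivative_char_speed[OF z])
  note nth = has_derivative_vec_nth[OF has_derivative_ident]
  have N: "((\<lambda>y. quad_form (char_speed i y) y) has_derivative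
      (\<lambda>v. quad_form x v + (2 * x * z $ 3 - 2 * z $ 2) * L v)) (at z)"
    unfolding quad_form_def
    by (auto intro!: derivative_eq_intros L nth simp: fun_eq_iff x_def[symmetric] algebra_simps)
  have D: "(metric_det has_derivative metric_det' z) (at z)"
    unfolding metric_det_def metric_det'_def
    by (auto intro!: derivative_eq_intros nth simp: fun_eq_iff algebra_simps)
  have s: "((\<lambda>y. char_speed i y * (1 - char_speed i y)) has_derivative (\<lambda>v. (1 - 2 * x) * L v)) (at z)"
    by (auto intro!: derivative_eq_intros L simp: fun_eq_iff x_def[symmetric] algebra_simps)
  have D0: "metric_det z > 0" using metric_domain_pos[OF z] by simp
  have s0: "x * (1 - x) \<noteq> 0"
    using root_interval_avoids[OF char_speed(1)[OF z]] by (simp add: x_def)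
  have N0: "quad_form x z > 0" by (rule quad_form_pos[OF z])
  \<comment> \<open>Criticality of \<open>quad_form x z ^ 3 / (x * (1 - x))\<^sup>2\<close> in
    \<open>x\<close>; the two sides differ by \<open>- 2 * char_poly x z\<close>.\<close>
  have crit: "3 * (2 * x * z $ 3 - 2 * z $ 2) * (x * (1 - x)) = 2 * (1 - 2 * x) * quad_form x z"
    using char_speed(2)[OF z, of i] unfolding x_def[symmetric] char_poly_def quad_form_def by algebra
  define \<rho> where "\<rho> = 3 * (quad_form x z)\<^sup>2 / (metric_det z ^ 3 * (x * (1 - x))\<^sup>2)"
  have "(riemann_invariant i has_derivative (\<lambda>v. (quad_form x z)\<^sup>2 *
      (3 * (quad_form x v + (2 * x * z $ 3 - 2 * z $ 2) * L v) * metric_det z * (x * (1 - x)) -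
       2 * quad_form x z * (metric_det' z v * (x * (1 - x)) + metric_det z * ((1 - 2 * x) * L v))) /
      (metric_det z ^ 3 * (x * (1 - x)) ^ 3))) (at z)"
    using has_derivative_cube_div[OF N D s] D0 s0
    unfolding x_def[symmetric] riemann_invariant_def by simp
  moreover have "(quad_form x z)\<^sup>2 *
      (3 * (quad_form x v + (2 * x * z $ 3 - 2 * z $ 2) * L v) * metric_det z * (x * (1 - x)) -
       2 * quad_form x z * (metric_det' z v * (x * (1 - x)) + metric_det z * ((1 - 2 * x) * L v))) /
      (metric_det z ^ 3 * (x * (1 - x)) ^ 3) = \<rho> * invariant_form x z v" for v
  proof -
    have "3 * (quad_form x v + (2 * x * z $ 3 - 2 * z $ 2) * L v) * metric_det z * (x * (1 - x)) -
       2 * quad_form x z * (metric_det' z v * (x * (1 - x)) + metric_det z * ((1 - 2 * x) * L v)) =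
       (x * (1 - x)) * (3 * invariant_form x z v) +
       metric_det z * L v * (3 * (2 * x * z $ 3 - 2 * z $ 2) * (x * (1 - x)) - 2 * (1 - 2 * x) * quad_form x z)"
      by (simp add: invariant_form_def algebra_simps)
    also have "\<dots> = (x * (1 - x)) * (3 * invariant_form x z v)"
      unfolding crit by simp
    finally have num: "3 * (quad_form x v + (2 * x * z $ 3 - 2 * z $ 2) * L v) * metric_det z * (x * (1 - x)) -
       2 * quad_form x z * (metric_det' z v * (x * (1 - x)) + metric_det z * ((1 - 2 * x) * L v)) =
       (x * (1 - x)) * (3 * invariant_form x z v)" .
    have "n\<^sup>2 * (s * (3 * I)) / (d ^ 3 * s ^ 3) = 3 * n\<^sup>2 / (d ^ 3 * s\<^sup>2) * I" if "s \<noteq> 0" for n s d I :: real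
      using that by (simp add: power2_eq_square power3_eq_cube mult_ac)
    from this[OF s0] show ?thesis
      unfolding num \<rho>_def by simp
  qed
  ultimately have "(riemann_invariant i has_derivative (\<lambda>v. \<rho> * invariant_form x z v)) (at z)"
    by simp
  moreover have "\<rho> \<noteq> 0"
    using N0 D0 s0 by (simp add: \<rho>_def)
  ultimately show ?thesis
    using that by (simp add: x_def)
qed

lemma smooth_on_riemann_invariant: "smooth_on (riemann_invariant i) metric_domain"
  unfolding riemann_invariant_def
proof (intro smooth_on_divide open_metric_domain)
  note intros = smooth_on_intros open_metric_domain smooth_on_char_speed
  show "smooth_on (\<lambda>z. quad_form (char_speed i z) z ^ 3) metric_domain"
    unfolding quad_form_def by (intro intros)
  show "smooth_on (\<lambda>z. (metric_det z)\<^sup>2 * (char_speed i z * (1 - char_speed i z))\<^sup>2) metric_domain"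
    unfolding metric_det_def by (intro intros)
  show "(metric_det z)\<^sup>2 * (char_speed i z * (1 - char_speed i z))\<^sup>2 \<noteq> 0" if "z \<in> metric_domain" for z
    using metric_domain_pos(3)[OF that] root_interval_avoids[OF char_speed(1)[OF that]] by simp
qed

lemma metric_system_iff:
  assumes Z: "(Z has_derivative Z') (at w)" and w: "Z w \<in> metric_domain"
  shows "metric_system Z w \<longleftrightarrow>
    (\<forall>i. invariant_form (char_speed i (Z w)) (Z w) (Z' (axis 1 1)) =
         char_speed i (Z w) * invariant_form (char_speed i (Z w)) (Z w) (Z' (axis 2 1)))"
proof -
  have pd: "pd k (\<lambda>w. Z w $ i) w = Z' (axis k 1) $ i" for k i
    by (rule pd_eqI[OF has_derivative_vec_nth[OF Z]])
  show ?thesis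
    unfolding metric_system_def Let_def pd system_iff_invariant_form[OF w, symmetric] ..
qed

lemma diagonalizable_metric_system: "diagonalizable_on metric_domain metric_system"
  unfolding diagonalizable_on_def
proof
  fix z0 assume z0: "z0 \<in> metric_domain"
  define R where "R = (\<lambda>z. \<chi> i. riemann_invariant i z)"
  have R: "(\<lambda>z. R z $ i) = riemann_invariant i" for i
    by (simp add: R_def)
  have sm: "smooth_on (\<lambda>z. R z $ i) metric_domain" for i
    by (simp add: R smooth_on_riemann_invariant)
  \<comment> \<open>Row \<open>i\<close> of the Jacobian is a nonzero multiple of the form
    \<open>invariant_form (char_speed i z0) z0\<close>, and these three forms have trivial common
    kernel.\<close>
  have "v = 0" if "jacobian_matrix R z0 *v v = 0" for v
  proof (rule invariant_form_nondegenerate[OF z0])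
    fix i
    obtain \<rho> where \<rho>: "\<rho> \<noteq> 0"
      "(riemann_invariant i has_derivative (\<lambda>v. \<rho> * invariant_form (char_speed i z0) z0 v)) (at z0)"
      by (rule has_derivative_riemann_invariant[OF z0])
    have "(riemann_invariant i has_derivative (\<lambda>v. (jacobian_matrix R z0 *v v) $ i)) (at z0)"
      using has_derivative_vec_nth[OF has_derivative_jacobian_matrix[OF open_metric_domain sm z0], of i]
      by (simp add: R)
    from has_derivative_unique[OF this \<rho>(2)] that \<rho>(1)
    show "invariant_form (char_speed i z0) z0 v = 0"
      by (metis mult_eq_0_iff zero_index)
  qed
  then have "det (jacobian_matrix R z0) \<noteq> 0"
    by (metis invertible_det_nz invertible_left_inverse matrix_left_invertible_ker)
  then obtain U V where U: "z0 \<in> U" "U \<subseteq> metric_domain" and d: "diffeo_on U V R"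
    using diffeo_on_local[OF open_metric_domain z0 sm] by metis
  define lam where "lam = (\<lambda>i r. char_speed i (inv_into U R r))"
  have UV: "open U" "open V" "bij_betw R U V" "\<And>i. smooth_on (\<lambda>r. inv_into U R r $ i) V"
    using d by (auto simp: diffeo_on_def)
  have inv: "inv_into U R ` V \<subseteq> U"
    using bij_betw_inv_into[OF UV(3)] by (simp add: bij_betw_def)
  have "smooth_on (lam i) V" for i
    unfolding lam_def
    by (rule smooth_on_compose[OF UV(2,1) inv smooth_on_subset[OF smooth_on_char_speed U(2)] UV(4)])
  moreover have "metric_system Z w \<longleftrightarrow> diagonal_system lam (\<lambda>w. R (Z w)) w"
    if Z: "Z differentiable (at w)" "Z w \<in> U" for Z w
  proof -
    obtain Z' where Z': "(Z has_derivative Z') (at w)"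
      using Z(1) by (auto simp: differentiable_def)
    have zw: "Z w \<in> metric_domain" using Z(2) U(2) by blast
    have lam: "lam i (R (Z w)) = char_speed i (Z w)" for i
      using bij_betw_inv_into_left[OF UV(3) Z(2)] by (simp add: lam_def)
    \<comment> \<open>The factor \<rho> occurs on both sides and cancels, so the two systems match
      equation by equation at the single point \<open>w\<close>.\<close>
    have "pd 1 (\<lambda>w. R (Z w) $ i) w = lam i (R (Z w)) * pd 2 (\<lambda>w. R (Z w) $ i) w \<longleftrightarrow>
      invariant_form (char_speed i (Z w)) (Z w) (Z' (axis 1 1)) =
         char_speed i (Z w) * invariant_form (char_speed i (Z w)) (Z w) (Z' (axis 2 1))" for i
    proof -
      obtain \<rho> where \<rho>: "\<rho> \<noteq> 0" "(riemann_invariant i has_derivative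
          (\<lambda>v. \<rho> * invariant_form (char_speed i (Z w)) (Z w) v)) (at (Z w))"
        by (rule has_derivative_riemann_invariant[OF zw])
      have "((\<lambda>w. R (Z w) $ i) has_derivative
          (\<lambda>h. \<rho> * invariant_form (char_speed i (Z w)) (Z w) (Z' h))) (at w)"
        using has_derivative_compose[OF Z' \<rho>(2)] by (simp add: R_def)
      from pd_eqI[OF this] show ?thesis
        unfolding lam using \<rho>(1) by (simp add: mult.left_commute)
    qed
    then show ?thesis
      unfolding diagonal_system_def metric_system_iff[OF Z' zw] by blast
  qed
  ultimately have "diagonal_form metric_system U V R lam"
    unfolding diagonal_form_def using d by blast
  with U show "\<exists>U V R lam. z0 \<in> U \<and> U \<subseteq> metric_domain \<and> diagonal_form metric_system U V R lam"
    by blast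
qed

section \<open>The semi-Hamiltonian property\<close>

lemma pd_eq_of_DERIV:
  "((\<lambda>t. f (x + t *\<^sub>R axis k 1)) has_real_derivative d) (at 0) \<Longrightarrow> pd k f x = d"
  unfolding pd_def by (rule DERIV_imp_deriv)

lemma smooth_on_DERIV_axis:
  assumes "open S" "smooth_on f S" "x \<in> S"
  shows "((\<lambda>t. f (x + t *\<^sub>R axis k 1)) has_real_derivative pd k f x) (at 0)"
  using has_real_derivative_along_axis[of f x 0 k] smooth_on_has_derivative[OF assms]
  by (auto simp: differentiable_def)

lemma pd_commute_smooth_on:
  "open S \<Longrightarrow> smooth_on f S \<Longrightarrow> x \<in> S \<Longrightarrow> pd j (pd k f) x = pd k (pd j f) x"
  by (rule pd_commute) (simp_all add: smooth_on_def)

lemma other_index_3: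
  fixes i j :: 3
  assumes "i \<noteq> j"
  obtains k where "k \<noteq> i" "k \<noteq> j"
  using exhaust_3[of i] exhaust_3[of j] assms that[of 1] that[of 2] that[of 3] by auto

text \<open>With \<open>x\<close>, \<open>y\<close>, \<open>z\<close> for the speeds
  \<open>i\<close>, \<open>j\<close>, \<open>k\<close>, the left side is the logarithmic derivative
  computed in the next lemma. The factor \<open>x - y\<close> on the right cancels one of two such
  factors in the denominator there, which restores symmetry.\<close>

lemma cross_derivative_identity:
  fixes x y z :: real
  assumes "x \<noteq> y" "x \<noteq> z" "y \<noteq> z"
  shows "3 / 2 * (1 - 2 * x) / (x - z) + (- 1 / 2 - 3 / 2 * (y * (1 - y) + z * (1 - z)) / (y - z)\<^sup>2) - 1
      - 3 / (x - y) * (x * (1 - x) / (x - z) - y * (1 - y) / (y - z)) =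
    - 3 / 2 * (x - y) * (y + z - 2 * y * z) / ((x - z) * (y - z)\<^sup>2)"
proof -
  have "x * (1 - x) / (x - z) - y * (1 - y) / (y - z) =
      - (x - y) * (x * y + z - z * x - z * y) / ((x - z) * (y - z))"
    using assms by (simp add: divide_simps) (simp add: algebra_simps power2_eq_square)
  moreover have "3 / d * (- d * m / n) = - 3 * m / n" if "d \<noteq> 0" for d m n :: real
    using that by simp
  ultimately have 1: "3 / (x - y) * (x * (1 - x) / (x - z) - y * (1 - y) / (y - z)) =
      - 3 * (x * y + z - z * x - z * y) / ((x - z) * (y - z))"
    using assms(1) by (metis right_minus_eq)
  have 2: "(- 1 / 2 - 3 / 2 * (y * (1 - y) + z * (1 - z)) / (y - z)\<^sup>2) - 1 =
      - 3 / 2 * (y + z - 2 * y * z) / (y - z)\<^sup>2"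
    using assms by (simp add: divide_simps) (simp add: algebra_simps power2_eq_square)
  have "3 / 2 * (1 - 2 * x) / (x - z) + - 3 / 2 * (y + z - 2 * y * z) / (y - z)\<^sup>2 -
      - 3 * (x * y + z - z * x - z * y) / ((x - z) * (y - z)) =
      (3 / 2 * (1 - 2 * x) * (y - z)\<^sup>2 - 3 / 2 * (y + z - 2 * y * z) * (x - z) +
       3 * (x * y + z - z * x - z * y) * (y - z)) / ((x - z) * (y - z)\<^sup>2)"
    using assms by (simp add: divide_simps) (simp add: algebra_simps power2_eq_square)
  also have "3 / 2 * (1 - 2 * x) * (y - z)\<^sup>2 - 3 / 2 * (y + z - 2 * y * z) * (x - z) +
       3 * (x * y + z - z * x - z * y) * (y - z) = - 3 / 2 * (x - y) * (y + z - 2 * y * z)"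
    by (simp add: field_simps power2_eq_square)
  finally show ?thesis
    unfolding 1 2[symmetric] by simp
qed

text \<open>The functions \<open>a\<close>, \<open>b\<close>, \<open>c\<close> are the components of
  \<psi> in terms of Riemann invariants; the metric enters only through them.\<close>

lemma semi_hamiltonian_speeds_of_quad_form:
  fixes l :: "3 \<Rightarrow> real^3 \<Rightarrow> real" and a b c :: "real^3 \<Rightarrow> real"
  assumes V: "open V" and sm: "\<And>i. smooth_on (l i) V" "smooth_on a V" "smooth_on b V" "smooth_on c V"
    and c: "\<And>r. r \<in> V \<Longrightarrow> c r \<noteq> 0"
    and distinct: "\<And>i j r. r \<in> V \<Longrightarrow> i \<noteq> j \<Longrightarrow> l i r \<noteq> l j r"
    and root: "\<And>i r. r \<in> V \<Longrightarrow>
      (l i r)\<^sup>2 * (l i r - 2) * c r + l i r * (l i r + 1) * b r + (1 - 2 * l i r) * a r = 0"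
    and orth: "\<And>i j r. r \<in> V \<Longrightarrow> i \<noteq> j \<Longrightarrow>
      pd j a r - 2 * l i r * pd j b r + (l i r)\<^sup>2 * pd j c r = 0"
  shows "semi_hamiltonian_speeds V l"
proof -
  note D = smooth_on_DERIV_axis[OF V]
  \<comment> \<open>For fixed \<open>j\<close> the quadratic polynomial
    \<open>a\<^sub>j - 2 x b\<^sub>j + x\<^sup>2 c\<^sub>j\<close> has the roots \<open>l i\<close>
    and \<open>l k\<close>, so its coefficients are given by Vieta's formulas.\<close>
  have b_eq: "2 * pd j b r = (l i r + l k r) * pd j c r"
    and a_eq: "pd j a r = l i r * l k r * pd j c r"
    if "r \<in> V" "i \<noteq> j" "i \<noteq> k" "j \<noteq> k" for i j k r
  proof -
    have "(l i r - l k r) * (2 * pd j b r - (l i r + l k r) * pd j c r) = 0"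
      using orth[OF that(1,2)] orth[OF that(1) that(4)[symmetric]] by algebra
    then show b: "2 * pd j b r = (l i r + l k r) * pd j c r"
      using distinct[OF that(1,3)] by simp
    show "pd j a r = l i r * l k r * pd j c r"
      using orth[OF that(1,2)] b by algebra
  qed
  have vieta: "b r - 2 * c r = - c r * (l i r + l j r + l k r)"
    "b r - 2 * a r = c r * (l i r * l j r + l i r * l k r + l j r * l k r)"
    if "r \<in> V" "i \<noteq> j" "i \<noteq> k" "j \<noteq> k" for i j k r
  proof -
    have "c r * y ^ 3 + (b r - 2 * c r) * y\<^sup>2 + (b r - 2 * a r) * y + a r = 0"
      if "y \<in> {l i r, l j r, l k r}" for y
    proof -
      have "y\<^sup>2 * (y - 2) * c r + y * (y + 1) * b r + (1 - 2 * y) * a r = 0"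
        using that root[OF \<open>r \<in> V\<close>] by blast
      then show ?thesis
        by (simp add: power2_eq_square power3_eq_cube algebra_simps)
    qed
    from cubic_vieta(1,2)[OF _ _ _ this] distinct[OF that(1)] that
    show "b r - 2 * c r = - c r * (l i r + l j r + l k r)"
      "b r - 2 * a r = c r * (l i r * l j r + l i r * l k r + l j r * l k r)"
      by blast+
  qed
  \<comment> \<open>Differentiate the root equation. Both the derivative in the root and the
    remaining terms contain the factor \<open>l i - l k\<close>, which is then cancelled.\<close>
  have pd_l: "c r * (l i r - l j r) * pd j (l i) r = 3 / 2 * pd j c r * (l i r * (1 - l i r))"
    if r: "r \<in> V" and ij: "i \<noteq> j" for i j r
  proof -
    obtain k where k: "k \<noteq> i" "k \<noteq> j" using other_index_3[OF ij] by blast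
    let ?x = "l i r" and ?dx = "pd j (l i) r"
    have "pd j (\<lambda>r. (l i r)\<^sup>2 * (l i r - 2) * c r + l i r * (l i r + 1) * b r + (1 - 2 * l i r) * a r) r =
        pd j (\<lambda>r. 0) r"
      by (rule pd_cong[OF V r root])
    also have "\<dots> = 0" by (rule pd_eq_of_DERIV) simp
    also have "pd j (\<lambda>r. (l i r)\<^sup>2 * (l i r - 2) * c r + l i r * (l i r + 1) * b r + (1 - 2 * l i r) * a r) r =
        ?x\<^sup>2 * (?x - 2) * pd j c r + ?x * (?x + 1) * pd j b r + (1 - 2 * ?x) * pd j a r +
        ((3 * ?x\<^sup>2 - 4 * ?x) * c r + (2 * ?x + 1) * b r - 2 * a r) * ?dx"
      by (rule pd_eq_of_DERIV)
         (auto intro!: derivative_eq_intros D[OF _ r] sm simp: power2_eq_square algebra_simps)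
    finally have eq: "?x\<^sup>2 * (?x - 2) * pd j c r + ?x * (?x + 1) * pd j b r + (1 - 2 * ?x) * pd j a r +
        ((3 * ?x\<^sup>2 - 4 * ?x) * c r + (2 * ?x + 1) * b r - 2 * a r) * ?dx = 0" .
    have "(3 * ?x\<^sup>2 - 4 * ?x) * c r + (2 * ?x + 1) * b r - 2 * a r =
        3 * ?x\<^sup>2 * c r + 2 * ?x * (b r - 2 * c r) + (b r - 2 * a r)"
      by (simp add: algebra_simps)
    also have "\<dots> = c r * (?x - l j r) * (?x - l k r)"
      unfolding vieta[OF r ij k(1)[symmetric] k(2)[symmetric]]
      by (simp add: power2_eq_square algebra_simps)
    finally have A: "(3 * ?x\<^sup>2 - 4 * ?x) * c r + (2 * ?x + 1) * b r - 2 * a r =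
        c r * (?x - l j r) * (?x - l k r)" .
    have bj: "pd j b r = (?x + l k r) * pd j c r / 2"
      using b_eq[OF r ij k(1)[symmetric] k(2)[symmetric]] by simp
    have B: "?x\<^sup>2 * (?x - 2) * pd j c r + ?x * (?x + 1) * pd j b r + (1 - 2 * ?x) * pd j a r =
        - 3 / 2 * pd j c r * (?x * (1 - ?x)) * (?x - l k r)"
      unfolding bj a_eq[OF r ij k(1)[symmetric] k(2)[symmetric]]
      by (simp add: field_simps power2_eq_square)
    have "(?x - l k r) * (c r * (?x - l j r) * ?dx - 3 / 2 * pd j c r * (?x * (1 - ?x))) = 0"
      using eq unfolding A B by (simp add: algebra_simps)
    then show ?thesis
      using distinct[OF r k(1)] by simp
  qed
  \<comment> \<open>The preceding formula excludes the derivative of a speed in its own variable;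
    this one comes from differentiating the sum of the roots.\<close>
  have pd_l_self: "c r * pd j (l j) r =
      pd j c r * (2 - (l i r + l k r) / 2 - (l i r + l j r + l k r)) - c r * pd j (l i) r - c r * pd j (l k) r"
    if r: "r \<in> V" and ijk: "i \<noteq> j" "i \<noteq> k" "j \<noteq> k" for i j k r
  proof -
    have "pd j (\<lambda>r. b r - 2 * c r) r = pd j (\<lambda>r. - c r * (l i r + l j r + l k r)) r"
      by (rule pd_cong[OF V r vieta(1)[OF _ ijk]])
    moreover have "pd j (\<lambda>r. b r - 2 * c r) r = pd j b r - 2 * pd j c r"
      by (rule pd_eq_of_DERIV) (auto intro!: derivative_eq_intros D[OF _ r] sm)
    moreover have "pd j (\<lambda>r. - c r * (l i r + l j r + l k r)) r =
        - pd j c r * (l i r + l j r + l k r) - c r * (pd j (l i) r + pd j (l j) r + pd j (l k) r)"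
      by (rule pd_eq_of_DERIV) (auto intro!: derivative_eq_intros D[OF _ r] sm)
    ultimately show ?thesis
      using b_eq[OF r ijk] by (simp add: field_simps)
  qed
  have pd_b2: "2 * pd k (pd j b) r = (pd k (l i) r + pd k (l k) r) * pd j c r + (l i r + l k r) * pd k (pd j c) r"
    if r: "r \<in> V" and ijk: "i \<noteq> j" "i \<noteq> k" "j \<noteq> k" for i j k r
  proof -
    have "pd k (\<lambda>r. 2 * pd j b r) r = pd k (\<lambda>r. (l i r + l k r) * pd j c r) r"
      by (rule pd_cong[OF V r b_eq[OF _ ijk]])
    moreover have "pd k (\<lambda>r. 2 * pd j b r) r = 2 * pd k (pd j b) r"
      by (rule pd_eq_of_DERIV) (auto intro!: derivative_eq_intros D[OF _ r] sm smooth_on_pd)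
    moreover have "pd k (\<lambda>r. (l i r + l k r) * pd j c r) r =
        (pd k (l i) r + pd k (l k) r) * pd j c r + (l i r + l k r) * pd k (pd j c) r"
      by (rule pd_eq_of_DERIV) (auto intro!: derivative_eq_intros D[OF _ r] sm smooth_on_pd)
    ultimately show ?thesis by simp
  qed
  \<comment> \<open>Equality of the mixed derivatives of \<open>b\<close>, both expressed through
    \<open>c\<close> by \<open>pd_b2\<close>, is a linear equation for the mixed derivative of
    \<open>c\<close> with coefficient \<open>l k - l j\<close>.\<close>
  have pd_c2: "pd k (pd j c) r = pd j c r * pd k c r / c r *
      (- 1 / 2 - 3 / 2 * (l j r * (1 - l j r) + l k r * (1 - l k r)) / (l j r - l k r)\<^sup>2)"
    if r: "r \<in> V" and ijk: "i \<noteq> j" "i \<noteq> k" "j \<noteq> k" for i j k r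
  proof -
    let ?x = "l i r" and ?y = "l j r" and ?z = "l k r"
    let ?C = "pd k (pd j c) r" and ?cj = "pd j c r" and ?ck = "pd k c r"
    have yz: "?y \<noteq> ?z" by (rule distinct[OF r ijk(3)])
    have "(pd k (l i) r + pd k (l k) r) * ?cj + (?x + ?z) * ?C =
        (pd j (l i) r + pd j (l j) r) * ?ck + (?x + ?y) * ?C"
      using pd_b2[OF r ijk] pd_b2[OF r ijk(2,1) ijk(3)[symmetric]]
        pd_commute_smooth_on[OF V sm(3) r, of j k] pd_commute_smooth_on[OF V sm(4) r, of j k] by simp
    then have "c r * (?z - ?y) * ?C =
        (c r * pd j (l i) r + c r * pd j (l j) r) * ?ck - (c r * pd k (l i) r + c r * pd k (l k) r) * ?cj"
      by algebra
    \<comment> \<open>Replacing the derivatives of \<open>l j\<close> and \<open>l k\<close> in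
      their own variables also removes those of \<open>l i\<close>, so the result involves only the
      speeds \<open>j\<close> and \<open>k\<close>.\<close>
    also have "\<dots> = (?cj * (2 - (?x + ?z) / 2 - (?x + ?y + ?z)) - c r * pd j (l k) r) * ?ck -
        (?ck * (2 - (?x + ?y) / 2 - (?x + ?z + ?y)) - c r * pd k (l j) r) * ?cj"
      using pd_l_self[OF r ijk] pd_l_self[OF r ijk(2,1) ijk(3)[symmetric]] by simp
    also have "\<dots> = ?cj * ?ck * (?y - ?z) / 2 + c r * pd k (l j) r * ?cj - c r * pd j (l k) r * ?ck"
      by (simp add: field_simps)
    finally have C: "c r * (?z - ?y) * ?C =
        ?cj * ?ck * (?y - ?z) / 2 + c r * pd k (l j) r * ?cj - c r * pd j (l k) r * ?ck" .
    have "(c r * (?z - ?y) * ?C) * (?y - ?z) =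
        ?cj * ?ck * (?y - ?z)\<^sup>2 / 2 + (c r * (?y - ?z) * pd k (l j) r) * ?cj +
        (c r * (?z - ?y) * pd j (l k) r) * ?ck"
      unfolding C by (simp add: field_simps power2_eq_square)
    also have "\<dots> = ?cj * ?ck * (?y - ?z)\<^sup>2 / 2 +
        3 / 2 * (?y * (1 - ?y) + ?z * (1 - ?z)) * ?cj * ?ck"
      unfolding pd_l[OF r ijk(3)] pd_l[OF r ijk(3)[symmetric]] by (simp add: field_simps)
    finally have "c r * (?y - ?z)\<^sup>2 * ?C = ?cj * ?ck *
        (- 1 / 2 * (?y - ?z)\<^sup>2 - 3 / 2 * (?y * (1 - ?y) + ?z * (1 - ?z)))"
      by (simp add: field_simps power2_eq_square)
    then show ?thesis
      using c[OF r] yz by (simp add: field_simps)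
  qed
  have quot: "pd j (l i) r / (l j r - l i r) =
      - 3 / 2 * (l i r * (1 - l i r)) * pd j c r / (c r * (l i r - l j r)\<^sup>2)"
    if r: "r \<in> V" and ij: "i \<noteq> j" for i j r
  proof -
    have dl: "pd j (l i) r = 3 / 2 * pd j c r * (l i r * (1 - l i r)) / (c r * (l i r - l j r))"
      using pd_l[OF r ij] c[OF r] distinct[OF r ij] by (simp add: field_simps)
    have "3 / 2 * m * s / (C * d) / (- d) = - 3 / 2 * s * m / (C * d\<^sup>2)" for m s C d :: real
      by (simp add: power2_eq_square mult_ac)
    from this[of _ _ _ "l i r - l j r"] show ?thesis
      unfolding dl minus_diff_eq .
  qed
  \<comment> \<open>The right-hand side is unchanged when \<open>j\<close> and \<open>k\<close> are
    exchanged, which is the required identity.\<close>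
  have cross: "pd k (\<lambda>r. pd j (l i) r / (l j r - l i r)) r =
      9 / 4 * (l i r * (1 - l i r)) * (pd j c r * pd k c r) * (l j r + l k r - 2 * l j r * l k r) /
      ((c r)\<^sup>2 * (l i r - l j r) * (l i r - l k r) * (l j r - l k r)\<^sup>2)"
    if r: "r \<in> V" and ijk: "i \<noteq> j" "i \<noteq> k" "j \<noteq> k" for i j k r
  proof -
    let ?x = "l i r" and ?y = "l j r" and ?z = "l k r"
    let ?cj = "pd j c r" and ?ck = "pd k c r"
    let ?\<Gamma> = "- 1 / 2 - 3 / 2 * (?y * (1 - ?y) + ?z * (1 - ?z)) / (?y - ?z)\<^sup>2"
    have ne: "?x \<noteq> ?y" "?x \<noteq> ?z" "?y \<noteq> ?z" "c r \<noteq> 0"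
      using distinct[OF r] ijk c[OF r] by auto
    have xk: "pd k (l i) r = 3 / 2 * ?ck * (?x * (1 - ?x)) / (c r * (?x - ?z))"
      using pd_l[OF r ijk(2)] ne by (simp add: field_simps)
    have yk: "pd k (l j) r = 3 / 2 * ?ck * (?y * (1 - ?y)) / (c r * (?y - ?z))"
      using pd_l[OF r ijk(3)] ne by (simp add: field_simps)
    have "pd k (\<lambda>r. pd j (l i) r / (l j r - l i r)) r =
        pd k (\<lambda>r. - 3 / 2 * (l i r * (1 - l i r)) * pd j c r / (c r * (l i r - l j r)\<^sup>2)) r"
      by (rule pd_cong[OF V r quot[OF _ ijk(1)]])
    also have "\<dots> = - 3 / 2 * (((1 - 2 * ?x) * pd k (l i) r * ?cj + ?x * (1 - ?x) * pd k (pd j c) r) *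
          (c r * (?x - ?y)\<^sup>2) -
        ?x * (1 - ?x) * ?cj * (?ck * (?x - ?y)\<^sup>2 + c r * (2 * (?x - ?y) * (pd k (l i) r - pd k (l j) r)))) /
        (c r * (?x - ?y)\<^sup>2)\<^sup>2"
    proof (rule pd_eq_of_DERIV)
      have num: "((\<lambda>t. - 3 / 2 * (l i (r + t *\<^sub>R axis k 1) * (1 - l i (r + t *\<^sub>R axis k 1))) *
          pd j c (r + t *\<^sub>R axis k 1)) has_real_derivative
          - 3 / 2 * ((1 - 2 * ?x) * pd k (l i) r * ?cj + ?x * (1 - ?x) * pd k (pd j c) r)) (at 0)"
        by (auto intro!: derivative_eq_intros D[OF _ r] sm smooth_on_pd simp: field_simps)
      have den: "((\<lambda>t. c (r + t *\<^sub>R axis k 1) * (l i (r + t *\<^sub>R axis k 1) - l j (r + t *\<^sub>R axis k 1))\<^sup>2)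
          has_real_derivative
          ?ck * (?x - ?y)\<^sup>2 + c r * (2 * (?x - ?y) * (pd k (l i) r - pd k (l j) r))) (at 0)"
        by (auto intro!: derivative_eq_intros D[OF _ r] sm simp: power2_eq_square algebra_simps)
      have "(- 3 / 2 * A * d - (- 3 / 2 * s * m) * d') / (d * d) = - 3 / 2 * (A * d - s * m * d') / d\<^sup>2"
        for A d s m d' :: real
        by (simp add: power2_eq_square algebra_simps add_divide_distrib diff_divide_distrib)
      note eq = this[of "(1 - 2 * ?x) * pd k (l i) r * ?cj + ?x * (1 - ?x) * pd k (pd j c) r"
          "c r * (?x - ?y)\<^sup>2" "?x * (1 - ?x)" ?cj
          "?ck * (?x - ?y)\<^sup>2 + c r * (2 * (?x - ?y) * (pd k (l i) r - pd k (l j) r))"]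
      have "c (r + 0 *\<^sub>R axis k 1) * (l i (r + 0 *\<^sub>R axis k 1) - l j (r + 0 *\<^sub>R axis k 1))\<^sup>2 \<noteq> 0"
        using ne by simp
      from DERIV_divide[OF num den this]
      show "((\<lambda>t. - 3 / 2 * (l i (r + t *\<^sub>R axis k 1) * (1 - l i (r + t *\<^sub>R axis k 1))) *
          pd j c (r + t *\<^sub>R axis k 1) /
          (c (r + t *\<^sub>R axis k 1) * (l i (r + t *\<^sub>R axis k 1) - l j (r + t *\<^sub>R axis k 1))\<^sup>2))
          has_real_derivative
          - 3 / 2 * (((1 - 2 * ?x) * pd k (l i) r * ?cj + ?x * (1 - ?x) * pd k (pd j c) r) *
            (c r * (?x - ?y)\<^sup>2) -
          ?x * (1 - ?x) * ?cj * (?ck * (?x - ?y)\<^sup>2 + c r * (2 * (?x - ?y) * (pd k (l i) r - pd k (l j) r)))) /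
          (c r * (?x - ?y)\<^sup>2)\<^sup>2) (at 0)"
        unfolding scaleR_zero_left add_0_right eq .
    qed
    \<comment> \<open>The second factor is the logarithmic derivative in units of
      \<open>c\<^sub>k / c\<close>: its terms come from \<open>x (1 - x)\<close>, from
      \<open>c\<^sub>j\<close>, from \<open>c\<close> in the denominator and from
      \<open>(x - y)\<^sup>2\<close>.\<close>
    also have "\<dots> = - 3 / 2 * (?x * (1 - ?x)) * (?cj * ?ck) / ((c r)\<^sup>2 * (?x - ?y)\<^sup>2) *
        (3 / 2 * (1 - 2 * ?x) / (?x - ?z) + ?\<Gamma> - 1
          - 3 / (?x - ?y) * (?x * (1 - ?x) / (?x - ?z) - ?y * (1 - ?y) / (?y - ?z)))"
    proof -
      have gen: "- 3 / 2 * (((1 - 2 * x) * (3 / 2 * ck * s / (C * p)) * cj + s * (cj * ck / C * G)) * (C * d\<^sup>2) -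
          s * cj * (ck * d\<^sup>2 + C * (2 * d * (3 / 2 * ck * s / (C * p) - 3 / 2 * ck * t / (C * q))))) / (C * d\<^sup>2)\<^sup>2 =
          - 3 / 2 * s * (cj * ck) / (C\<^sup>2 * d\<^sup>2) * (3 / 2 * (1 - 2 * x) / p + G - 1 - 3 / d * (s / p - t / q))"
        if "C \<noteq> 0" "d \<noteq> 0" "p \<noteq> 0" "q \<noteq> 0" for x s t C ck cj p q d G :: real
        using that by (simp add: divide_simps) (simp add: algebra_simps power2_eq_square power4_eq_xxxx)
      show ?thesis
        unfolding xk yk pd_c2[OF r ijk]
        by (rule gen) (use ne in auto)
    qed
    also have "\<dots> = - 3 / 2 * (?x * (1 - ?x)) * (?cj * ?ck) / ((c r)\<^sup>2 * (?x - ?y)\<^sup>2) *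
        (- 3 / 2 * (?x - ?y) * (?y + ?z - 2 * ?y * ?z) / ((?x - ?z) * (?y - ?z)\<^sup>2))"
      unfolding cross_derivative_identity[OF ne(1-3)] ..
    also have "\<dots> = 9 / 4 * (?x * (1 - ?x)) * (?cj * ?ck) * (?y + ?z - 2 * ?y * ?z) /
        ((c r)\<^sup>2 * (?x - ?y) * (?x - ?z) * (?y - ?z)\<^sup>2)"
    proof -
      have "- 3 / 2 * s * m / (C * d\<^sup>2) * (- 3 / 2 * d * n / (p * q)) = 9 / 4 * s * m * n / (C * d * p * q)"
        if "d \<noteq> 0" for s m n C d p q :: real
        using that by (simp add: power2_eq_square)
      from this[of "?x - ?y"] ne(1) show ?thesis by simp
    qed
    finally show ?thesis .
  qed
  show ?thesis
    unfolding semi_hamiltonian_speeds_def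
  proof (intro conjI ballI allI impI)
    fix r i j k
    assume r: "r \<in> V" and ijk: "i \<noteq> (j::3)" "i \<noteq> k" "j \<noteq> k"
    show "pd k (\<lambda>r. pd j (l i) r / (l j r - l i r)) r = pd j (\<lambda>r. pd k (l i) r / (l k r - l i r)) r"
      unfolding cross[OF r ijk] cross[OF r ijk(2,1) ijk(3)[symmetric]]
      by (simp add: mult_ac add.commute power2_commute)
  qed (rule distinct)
qed

section \<open>From an arbitrary diagonal form to \<psi>\<close>

lemma metric_det'_add: "metric_det' z (v + w) = metric_det' z v + metric_det' z w"
  and metric_det'_scaleR: "metric_det' z (t *\<^sub>R v) = t * metric_det' z v"
  by (simp_all add: metric_det'_def algebra_simps)

lemma invariant_form_add: "invariant_form x z (v + w) = invariant_form x z v + invariant_form x z w"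
  and invariant_form_scaleR: "invariant_form x z (t *\<^sub>R v) = t * invariant_form x z v"
  by (simp_all add: invariant_form_def quad_form_add quad_form_scaleR metric_det'_add
      metric_det'_scaleR algebra_simps)

text \<open>Linear algebra at one point. If \<open>mu j\<close> is not the speed of index
  \<open>i\<close>, then form \<open>i\<close> kills \<open>\<xi> j\<close>; as the three forms
  separate vectors, every \<open>mu j\<close> is a speed. Two equal values would put two independent
  vectors into the common kernel of two of the forms, which is a line.\<close>

lemma speeds_of_eigenvectors:
  fixes mu :: "3 \<Rightarrow> real" and \<xi> :: "3 \<Rightarrow> real^3"
  assumes z: "z \<in> metric_domain"
    and eig: "\<And>i j. invariant_form (char_speed i z) z (mu j *\<^sub>R \<xi> j) =
        char_speed i z * invariant_form (char_speed i z) z (\<xi> j)"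
    and nz: "\<And>j. \<xi> j \<noteq> 0"
    and indep: "\<And>j k s t. j \<noteq> k \<Longrightarrow> s *\<^sub>R \<xi> j + t *\<^sub>R \<xi> k = 0 \<Longrightarrow> s = 0 \<and> t = 0"
  shows "char_poly (mu j) z = 0" "i \<noteq> j \<Longrightarrow> mu i \<noteq> mu j" "i \<noteq> j \<Longrightarrow> invariant_form (mu i) z (\<xi> j) = 0"
proof -
  let ?x = "\<lambda>i. char_speed i z"
  have eig0: "invariant_form (?x i) z (\<xi> j) = 0" if "mu j \<noteq> ?x i" for i j
    using eig[of i j] that by (simp add: invariant_form_scaleR)
  have ex: "\<exists>i. mu j = ?x i" for j
    using invariant_form_nondegenerate[OF z, of "\<xi> j"] nz[of j] eig0 by blast
  then show "char_poly (mu j) z = 0"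
    using char_speed(2)[OF z] by metis
  have neq: "mu i \<noteq> mu j" if "i \<noteq> j" for i j
  proof
    assume eq: "mu i = mu j"
    obtain m where m: "mu i = ?x m" using ex by blast
    define \<alpha> \<beta> where "\<alpha> = invariant_form (?x m) z (\<xi> i)" and "\<beta> = invariant_form (?x m) z (\<xi> j)"
    \<comment> \<open>The coefficients are chosen to make form \<open>m\<close> vanish; the other
      two forms already vanish on both vectors.\<close>
    have "invariant_form (?x n) z (\<beta> *\<^sub>R \<xi> i + (- \<alpha>) *\<^sub>R \<xi> j) = 0" for n
    proof (cases "n = m")
      case True
      then show ?thesis
        by (simp only: invariant_form_add invariant_form_scaleR \<alpha>_def \<beta>_def) simp
    next
      case False
      then have "mu i \<noteq> ?x n" "mu j \<noteq> ?x n"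
        using m eq char_speed_distinct[OF z, of n m] by auto
      then show ?thesis
        by (simp only: invariant_form_add invariant_form_scaleR eig0[OF \<open>mu i \<noteq> ?x n\<close>]
            eig0[OF \<open>mu j \<noteq> ?x n\<close>] mult_zero_right add_0)
    qed
    from invariant_form_nondegenerate[OF z this] have "\<beta> = 0 \<and> - \<alpha> = 0"
      by (rule indep[OF that])
    then have "invariant_form (?x n) z (\<xi> i) = 0" for n
      using eig0[of i n] m char_speed_distinct[OF z, of n m] by (cases "n = m") (auto simp: \<alpha>_def)
    from invariant_form_nondegenerate[OF z this] nz show False by blast
  qed
  then show "i \<noteq> j \<Longrightarrow> mu i \<noteq> mu j" .
  show "invariant_form (mu i) z (\<xi> j) = 0" if "i \<noteq> j"
  proof -
    obtain m where m: "mu i = ?x m" using ex by blast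
    then show ?thesis
      using eig0[of j m] neq[OF that] by simp
  qed
qed

text \<open>The given \<open>R\<close> need not be built from \<open>riemann_invariant\<close>. All
  that is used of the equivalence of the systems is its value on suitable affine test functions,
  which makes the coordinate vectors of \<open>R\<close> eigenvectors with the speeds
  \<open>lam\<close>.\<close>

lemma semi_hamiltonian_speeds_diagonal_form:
  assumes U: "U \<subseteq> metric_domain" and df: "diagonal_form metric_system U V R lam"
  shows "semi_hamiltonian_speeds V lam"
proof -
  define g where "g = inv_into U R"
  have UV: "open U" "open V" "bij_betw R U V" and smR: "\<And>i. smooth_on (\<lambda>z. R z $ i) U"
    and smg: "\<And>i. smooth_on (\<lambda>r. g r $ i) V" and sml: "\<And>i. smooth_on (lam i) V"
    and equiv: "\<And>Z w. Z differentiable (at w) \<Longrightarrow> Z w \<in> U \<Longrightarrow>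
        metric_system Z w \<longleftrightarrow> diagonal_system lam (\<lambda>w. R (Z w)) w"
    using df by (auto simp: diagonal_form_def diffeo_on_def g_def)
  have gU: "g r \<in> U" and Rg: "R (g r) = r" if "r \<in> V" for r
    using that UV(3) bij_betw_inv_into_right[OF UV(3)] bij_betwE[OF bij_betw_inv_into[OF UV(3)]]
    by (auto simp: g_def)
  have dom: "g r \<in> metric_domain" if "r \<in> V" for r
    using gU[OF that] U by blast
  \<comment> \<open>The coordinate vectors, that is, the partial derivatives of \<open>g\<close>; by
    the chain rule \<open>R\<close> has derivative \<open>axis j 1\<close> along them.\<close>
  define \<xi> where "\<xi> = (\<lambda>r j. jacobian_matrix g r *v axis j 1)"
  have \<xi>: "\<xi> r j $ i = pd j (\<lambda>r. g r $ i) r" for r i j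
    by (simp add: \<xi>_def jacobian_matrix_def matrix_vector_mult_basis column_def)
  have dR\<xi>: "jacobian_matrix R (g r) *v \<xi> r j = axis j 1" if r: "r \<in> V" for r j
  proof -
    have "((\<lambda>r. R (g r)) has_derivative (\<lambda>v. jacobian_matrix R (g r) *v (jacobian_matrix g r *v v))) (at r)"
      by (rule has_derivative_compose[OF has_derivative_jacobian_matrix[OF UV(2) smg r]
            has_derivative_jacobian_matrix[OF UV(1) smR gU[OF r]]])
    then have "((\<lambda>r. r) has_derivative (\<lambda>v. jacobian_matrix R (g r) *v (jacobian_matrix g r *v v))) (at r)"
      by (rule has_derivative_transform_within_open[OF _ UV(2) r]) (rule Rg)
    from has_derivative_unique[OF this has_derivative_ident] show ?thesis
      unfolding \<xi>_def by metis
  qed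
  have eig: "invariant_form (char_speed i (g r)) (g r) (lam j r *\<^sub>R \<xi> r j) =
      char_speed i (g r) * invariant_form (char_speed i (g r)) (g r) (\<xi> r j)" if r: "r \<in> V" for r i j
  proof -
    \<comment> \<open>To first order at 0 only invariant \<open>j\<close> varies, as a function of
      \<open>lam j r * u + v\<close>, so the diagonal system holds at 0 by construction.\<close>
    define Z' where "Z' = (\<lambda>w::real^2. (w $ 1 * lam j r + w $ 2) *\<^sub>R \<xi> r j)"
    define Z where "Z = (\<lambda>w. g r + Z' w)"
    have Z: "(Z has_derivative Z') (at 0)"
      unfolding Z_def Z'_def
      by (auto intro!: derivative_eq_intros has_derivative_vec_nth[OF has_derivative_ident])
    have Z0: "Z 0 = g r" by (simp add: Z_def Z'_def)
    have Z'1: "Z' (axis 1 1) = lam j r *\<^sub>R \<xi> r j" and Z'2: "Z' (axis 2 1) = \<xi> r j"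
      by (simp_all add: Z'_def axis_def)
    have "((\<lambda>w. R (Z w)) has_derivative (\<lambda>w. jacobian_matrix R (g r) *v Z' w)) (at 0)"
      using has_derivative_compose[OF Z, of R] has_derivative_jacobian_matrix[OF UV(1) smR gU[OF r]]
      by (simp add: Z0)
    then have pdRZ: "pd k (\<lambda>w. R (Z w) $ m) 0 = (jacobian_matrix R (g r) *v Z' (axis k 1)) $ m" for k m
      by (intro pd_eqI has_derivative_vec_nth)
    have "diagonal_system lam (\<lambda>w. R (Z w)) 0"
      unfolding diagonal_system_def pdRZ Z'1 Z'2 matrix_vector_mult_scaleR dR\<xi>[OF r] Z0 Rg[OF r]
      by (simp add: axis_def)
    then have "metric_system Z 0"
      using equiv[of Z 0] Z gU[OF r] by (auto simp: Z0 differentiable_def)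
    then show ?thesis
      using metric_system_iff[OF Z] dom[OF r] by (simp add: Z0 Z'1 Z'2)
  qed
  have nz: "\<xi> r j \<noteq> 0" if "r \<in> V" for r j
    using dR\<xi>[OF that, of j] by (auto simp: axis_eq_0_iff)
  have indep: "s = 0 \<and> t = 0" if r: "r \<in> V" and jk: "j \<noteq> k" and eq: "s *\<^sub>R \<xi> r j + t *\<^sub>R \<xi> r k = 0" for r j k s t
  proof -
    have "jacobian_matrix R (g r) *v (s *\<^sub>R \<xi> r j + t *\<^sub>R \<xi> r k) = s *\<^sub>R axis j 1 + t *\<^sub>R axis k 1"
      by (simp add: matrix_vector_right_distrib matrix_vector_mult_scaleR dR\<xi>[OF r])
    then have "s *\<^sub>R axis j 1 + t *\<^sub>R axis k 1 = (0 :: real^3)"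
      unfolding eq by simp
    then have "(s *\<^sub>R axis j 1 + t *\<^sub>R axis k 1 :: real^3) $ m = 0" for m
      by simp
    from this[of j] this[of k] jk show ?thesis
      by (simp add: axis_def)
  qed
  have speeds: "char_poly (lam i r) (g r) = 0" "i \<noteq> j \<Longrightarrow> lam i r \<noteq> lam j r"
    "i \<noteq> j \<Longrightarrow> invariant_form (lam i r) (g r) (\<xi> r j) = 0" if r: "r \<in> V" for r i j
  proof -
    note * = speeds_of_eigenvectors[where mu = "\<lambda>j. lam j r" and \<xi> = "\<xi> r",
        OF dom[OF r] eig[OF r] nz[OF r]]
    show "char_poly (lam i r) (g r) = 0"
      by (rule *(1)) (erule (1) indep[OF r])
    show "lam i r \<noteq> lam j r" if "i \<noteq> j"
      by (rule *(2)[OF _ that]) (erule (1) indep[OF r])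
    show "invariant_form (lam i r) (g r) (\<xi> r j) = 0" if "i \<noteq> j"
      by (rule *(3)[OF _ that]) (erule (1) indep[OF r])
  qed
  text \<open>For fixed \<open>x\<close> the derivative of \<open>quad_form x \<psi>\<close> is a multiple of \<open>invariant_form x z\<close>.\<close>
  define h where "h = (\<lambda>r. metric_det (g r) powr (- 2 / 3))"
  define \<psi> where "\<psi> = (\<lambda>i r. g r $ i * h r)"
  have hpos: "h r > 0" if "r \<in> V" for r
    using metric_domain_pos(3)[OF dom[OF that]] by (simp add: h_def)
  have smh: "smooth_on h V"
    unfolding h_def metric_det_def
    by (intro smooth_on_powr smooth_on_diff smooth_on_mult smooth_on_power smg UV(2))
       (use metric_domain_pos(3)[OF dom] in \<open>simp add: metric_det_def\<close>)
  have sm\<psi>: "smooth_on (\<psi> i) V" for i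
    unfolding \<psi>_def by (intro smooth_on_mult smg smh UV(2))
  \<comment> \<open>The product rule, with the bracket arranged as the vector that
    \<open>invariant_form_eq_quad_form\<close> feeds into \<open>quad_form\<close>.\<close>
  have pd\<psi>: "pd j (\<psi> i) r = h r / metric_det (g r) *
      (metric_det (g r) *\<^sub>R \<xi> r j - (2 / 3 * metric_det' (g r) (\<xi> r j)) *\<^sub>R g r) $ i"
    if r: "r \<in> V" for i j r
  proof -
    note dg = smooth_on_DERIV_axis[OF UV(2) smg r, of j, folded \<xi>]
    have pos: "metric_det (g r) > 0" by (rule metric_domain_pos(3)[OF dom[OF r]])
    have "((\<lambda>t. metric_det (g (r + t *\<^sub>R axis j 1))) has_real_derivative metric_det' (g r) (\<xi> r j)) (at 0)"
      unfolding metric_det_def metric_det'_def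
      by (auto intro!: derivative_eq_intros dg simp: algebra_simps)
    from DERIV_powr[OF this _ DERIV_const[of "- 2 / 3"]] pos
    have "((\<lambda>t. h (r + t *\<^sub>R axis j 1)) has_real_derivative
        - 2 / 3 * h r * metric_det' (g r) (\<xi> r j) / metric_det (g r)) (at 0)"
      by (simp add: h_def mult_ac)
    from DERIV_mult[OF dg this] show ?thesis
      unfolding \<psi>_def using pos by (intro pd_eq_of_DERIV) (simp add: field_simps)
  qed
  show ?thesis
  proof (rule semi_hamiltonian_speeds_of_quad_form[OF UV(2) sml sm\<psi>[of 1] sm\<psi>[of 2] sm\<psi>[of 3]])
    fix r i j assume r: "r \<in> V"
    show "\<psi> 3 r \<noteq> 0"
      using metric_domain_pos(2)[OF dom[OF r]] hpos[OF r] by (simp add: \<psi>_def)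
    show "(lam i r)\<^sup>2 * (lam i r - 2) * \<psi> 3 r + lam i r * (lam i r + 1) * \<psi> 2 r + (1 - 2 * lam i r) * \<psi> 1 r = 0"
    proof -
      have "(lam i r)\<^sup>2 * (lam i r - 2) * \<psi> 3 r + lam i r * (lam i r + 1) * \<psi> 2 r + (1 - 2 * lam i r) * \<psi> 1 r =
          h r * char_poly (lam i r) (g r)"
        by (simp add: \<psi>_def char_poly_def algebra_simps)
      then show ?thesis
        using speeds(1)[OF r] by simp
    qed
    assume ij: "i \<noteq> j"
    show "lam i r \<noteq> lam j r"
      by (rule speeds(2)[OF r ij])
    have "pd j (\<psi> 1) r - 2 * lam i r * pd j (\<psi> 2) r + (lam i r)\<^sup>2 * pd j (\<psi> 3) r =
        h r / metric_det (g r) * invariant_form (lam i r) (g r) (\<xi> r j)"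
      unfolding pd\<psi>[OF r] invariant_form_eq_quad_form quad_form_def by (simp only: algebra_simps)
    then show "pd j (\<psi> 1) r - 2 * lam i r * pd j (\<psi> 2) r + (lam i r)\<^sup>2 * pd j (\<psi> 3) r = 0"
      using speeds(3)[OF r ij] by simp
  qed
qed

theorem theorem1:
  shows "diagonalizable_on metric_domain metric_system \<and>
         semi_hamiltonian_on metric_domain metric_system"
  unfolding semi_hamiltonian_on_def
  using diagonalizable_metric_system semi_hamiltonian_speeds_diagonal_form by blast

end
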